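(* Let $T$ be an embedding tensor on a $3$-Lie algebra $(\mathfrak g,[\cdot,\cdot,\cdot]_{\mathfrak g})$ with respect to a representation $(V;\rho)$. Then $\big(\bigoplus_{k=1}^\infty\mathfrak C_T^k(V;\mathfrak g),\mathrm d^{\mathsf T}\big)$ is a cochain complex, i.e. $\mathrm d^{\mathsf T}\circ\mathrm d^{\mathsf T}=0$.
   Context: All vector spaces are over an algebraically closed field $\mathbb K$ of characteristic $0$. A $3$-Lie algebra is a vector space $\mathfrak g$ with a skew-symmetric trilinear bracket $[\cdot,\cdot,\cdot]_{\mathfrak g}$ such that $[x_1,x_2,[x_3,x_4,x_5]_{\mathfrak g}]_{\mathfrak g}=[[x_1,x_2,x_3]_{\mathfrak g},x_4,x_5]_{\mathfrak g}+[x_3,[x_1,x_2,x_4]_{\mathfrak g},x_5]_{\mathfrak g}+[x_3,x_4,[x_1,x_2,x_5]_{\mathfrak g}]_{\mathfrak g}$ for all $x_i\in\mathfrak g$. A representation of $\mathfrak g$ on a vector space $V$ is a linear map $\rho:\wedge^2\mathfrak g\to\mathfrak{gl}(V)$ such that for all $x_i\in\mathfrak g$: $\rho(x_1,x_2)\rho(x_3,x_4)=\rho([x_1,x_2,x_3]_{\mathfrak g},x_4)+\rho(x_3,[x_1,x_2,x_4]_{\mathfrak g})+\rho(x_3,x_4)\rho(x_1,x_2)$ and $\rho(x_1,[x_2,x_3,x_4]_{\mathfrak g})=\rho(x_3,x_4)\rho(x_1,x_2)-\rho(x_2,x_4)\rho(x_1,x_3)+\rho(x_2,x_3)\rho(x_1,x_4)$.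 An embedding tensor on $\mathfrak g$ with respect to $(V;\rho)$ is a linear map $T:V\to\mathfrak g$ with $[Tu,Tv,Tw]_{\mathfrak g}=T(\rho(Tu,Tv)w)$ for all $u,v,w\in V$. Given an embedding tensor $T$, put $[u,v,w]_T=\rho(Tu,Tv)w$, $l_T(u,v)(x)=[Tu,Tv,x]_{\mathfrak g}$, $m_T(u,v)(x)=[Tu,x,Tv]_{\mathfrak g}-T(\rho(Tu,x)v)$, $r_T=-m_T$ for $u,v,w\in V$, $x\in\mathfrak g$. For $U=u\otimes v$ write $[U,w]_T=[u,v,w]_T$ and $l_T(U)=l_T(u,v)$. For $n\ge1$ let $\mathfrak C^n_{\mathsf{3Leib}}(V;\mathfrak g)=\mathrm{Hom}((\otimes^2V)^{\otimes(n-1)}\otimes V,\mathfrak g)$, and let $\partial_T:\mathfrak C^n_{\mathsf{3Leib}}(V;\mathfrak g)\to\mathfrak C^{n+1}_{\mathsf{3Leib}}(V;\mathfrak g)$ be, for $U_i=u_i\otimes v_i\in\otimes^2V$, $w\in V$, $(\partial_T\theta)(U_1,\dots,U_n,w)=\sum_{1\le j<k\le n}(-1)^j\theta(U_1,\dots,\hat U_j,\dots,U_{k-1},[u_j,v_j,u_k]_T\otimes v_k,U_{k+1},\dots,U_n,w)$ $+\sum_{1\le j<k\le n}(-1)^j\theta(U_1,\dots,\hat U_j,\dots,U_{k-1},u_k\otimes[u_j,v_j,v_k]_T,U_{k+1},\dots,U_n,w)$ $+\sum_{j=1}^n\big((-1)^j\theta(U_1,\dots,\hat U_j,\dots,U_n,[U_j,w]_T)+(-1)^{j+1}l_T(U_j)\theta(U_1,\dots,\hat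 U_j,\dots,U_n,w)\big)$ $+(-1)^{n+1}\big(m_T(u_n,w)\theta(U_1,\dots,U_{n-1},v_n)+r_T(v_n,w)\theta(U_1,\dots,U_{n-1},u_n)\big)$. For $\mathfrak X\in\mathfrak g\wedge\mathfrak g$ define $\delta(\mathfrak X):V\to\mathfrak g$ by $\delta(\mathfrak X)v=T\rho(\mathfrak X)v-[\mathfrak X,Tv]_{\mathfrak g}$, where for $\mathfrak X=x\wedge y$, $[\mathfrak X,z]_{\mathfrak g}=[x,y,z]_{\mathfrak g}$ (extended linearly). Set $\mathfrak C_T^1(V;\mathfrak g)=\mathfrak g\wedge\mathfrak g$ and $\mathfrak C_T^k(V;\mathfrak g)=\mathfrak C^{k-1}_{\mathsf{3Leib}}(V;\mathfrak g)$ for $k\ge2$; $\mathrm d^{\mathsf T}:\mathfrak C_T^k(V;\mathfrak g)\to\mathfrak C_T^{k+1}(V;\mathfrak g)$ equals $\delta$ for $k=1$ and $\partial_T$ for $k\ge2$. *)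

theory Defs
  imports
    "HOL-Computational_Algebra.Computational_Algebra"
    "HOL-Library.Poly_Mapping"
    "HOL-Algebra.Module"
    "HOL-Algebra.Algebraic_Closure_Type"
begin

text \<open>
  A vector space is a type of class \<open>ab_group_add\<close> with a scalar multiplication satisfying the
  library locale \<open>vector_space\<close>; no dimension is finite by assumption. A linear map out of a
  tensor product is rendered as a multilinear map, and a linear map out of an exterior square as
  an alternating bilinear map. The exterior square itself, whose elements are needed as cochains of
  degree one, is constructed below as a quotient.
\<close>

subsection \<open>3-Lie algebras, representations, embedding tensors\<close>

locale three_lie_algebra = Vector_Spaces.vector_space sg
  for sg :: "'k::field \<Rightarrow> 'g::ab_group_add \<Rightarrow> 'g" +
  fixes br :: "'g \<Rightarrow> 'g \<Rightarrow> 'g \<Rightarrow> 'g"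
  assumes br_linear1: "Vector_Spaces.linear sg sg (\<lambda>x. br x y z)"
    and br_linear2: "Vector_Spaces.linear sg sg (\<lambda>y. br x y z)"
    and br_linear3: "Vector_Spaces.linear sg sg (\<lambda>z. br x y z)"
    and br_skew12: "br y x z = - br x y z"
    and br_skew23: "br x z y = - br x y z"
    and fundamental_identity:
      "br x1 x2 (br x3 x4 x5) =
         br (br x1 x2 x3) x4 x5 + br x3 (br x1 x2 x4) x5 + br x3 x4 (br x1 x2 x5)"

text \<open>\<open>rho x y v\<close> stands for $\rho(x,y)(v)$.\<close>

locale three_lie_representation =
  three_lie_algebra sg br + V: Vector_Spaces.vector_space sv
  for sg :: "'k::field \<Rightarrow> 'g::ab_group_add \<Rightarrow> 'g" and br
    and sv :: "'k \<Rightarrow> 'v::ab_group_add \<Rightarrow> 'v" +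
  fixes rho :: "'g \<Rightarrow> 'g \<Rightarrow> 'v \<Rightarrow> 'v"
  assumes rho_linear1: "Vector_Spaces.linear sg sv (\<lambda>x. rho x y v)"
    and rho_linear2: "Vector_Spaces.linear sg sv (\<lambda>y. rho x y v)"
    and rho_alternating: "rho x x v = 0"
    and rho_linear3: "Vector_Spaces.linear sv sv (rho x y)"
    and rho_comp:
      "rho x1 x2 (rho x3 x4 v) =
         rho (br x1 x2 x3) x4 v + rho x3 (br x1 x2 x4) v + rho x3 x4 (rho x1 x2 v)"
    and rho_br:
      "rho x1 (br x2 x3 x4) v =
         rho x3 x4 (rho x1 x2 v) - rho x2 x4 (rho x1 x3 v) + rho x2 x3 (rho x1 x4 v)"

locale embedding_tensor = three_lie_representation sg br sv rho
  for sg :: "'k::field \<Rightarrow> 'g::ab_group_add \<Rightarrow> 'g" and br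
    and sv :: "'k \<Rightarrow> 'v::ab_group_add \<Rightarrow> 'v" and rho +
  fixes T :: "'v \<Rightarrow> 'g"
  assumes T_linear: "Vector_Spaces.linear sv sg T"
    and T_embedding: "br (T u) (T v) (T w) = T (rho (T u) (T v) w)"

subsection \<open>The exterior square\<close>

text \<open>
  The exterior square of the space with scalar multiplication \<open>s\<close> is the free vector space on
  pairs (finitely supported functions) modulo the subspace spanned by the relations that make
  \<open>(x, y) \<mapsto> x \<and> y\<close> bilinear and alternating. Its elements are cosets.
\<close>

definition free_scale :: "'k::field \<Rightarrow> ('a \<Rightarrow>\<^sub>0 'k) \<Rightarrow> ('a \<Rightarrow>\<^sub>0 'k)" where
  "free_scale c f = Poly_Mapping.map ((*) c) f"

definition wedge_relators ::
    "('k::field \<Rightarrow> 'g::ab_group_add \<Rightarrow> 'g) \<Rightarrow> ('g \<times> 'g \<Rightarrow>\<^sub>0 'k) set" where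
  "wedge_relators s =
     (let e = (\<lambda>x y. Poly_Mapping.single (x, y) 1) in
       {e (x + x') y - e x y - e x' y | x x' y. True}
     \<union> {e x (y + y') - e x y - e x y' | x y y'. True}
     \<union> {e (s c x) y - free_scale c (e x y) | c x y. True}
     \<union> {e x (s c y) - free_scale c (e x y) | c x y. True}
     \<union> {e x x | x. True})"

definition wedge_rel ::
    "('k::field \<Rightarrow> 'g::ab_group_add \<Rightarrow> 'g) \<Rightarrow> (('g \<times> 'g \<Rightarrow>\<^sub>0 'k) \<times> ('g \<times> 'g \<Rightarrow>\<^sub>0 'k)) set" where
  "wedge_rel s = {(f, g). f - g \<in> module.span free_scale (wedge_relators s)}"

definition exterior_square ::
    "('k::field \<Rightarrow> 'g::ab_group_add \<Rightarrow> 'g) \<Rightarrow> ('g \<times> 'g \<Rightarrow>\<^sub>0 'k) set set" where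
  "exterior_square s = UNIV // wedge_rel s"

definition wedge ::
    "('k::field \<Rightarrow> 'g::ab_group_add \<Rightarrow> 'g) \<Rightarrow> 'g \<Rightarrow> 'g \<Rightarrow> ('g \<times> 'g \<Rightarrow>\<^sub>0 'k) set" where
  "wedge s x y = wedge_rel s `` {Poly_Mapping.single (x, y) 1}"

definition wedge_zero ::
    "('k::field \<Rightarrow> 'g::ab_group_add \<Rightarrow> 'g) \<Rightarrow> ('g \<times> 'g \<Rightarrow>\<^sub>0 'k) set" where
  "wedge_zero s = wedge_rel s `` {0}"

definition wedge_add ::
    "('k::field \<Rightarrow> 'g::ab_group_add \<Rightarrow> 'g) \<Rightarrow> ('g \<times> 'g \<Rightarrow>\<^sub>0 'k) set \<Rightarrow> ('g \<times> 'g \<Rightarrow>\<^sub>0 'k) set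
      \<Rightarrow> ('g \<times> 'g \<Rightarrow>\<^sub>0 'k) set" where
  "wedge_add s \<XX> \<YY> = (\<Union>f\<in>\<XX>. \<Union>g\<in>\<YY>. wedge_rel s `` {f + g})"

definition wedge_smult ::
    "('k::field \<Rightarrow> 'g::ab_group_add \<Rightarrow> 'g) \<Rightarrow> 'k \<Rightarrow> ('g \<times> 'g \<Rightarrow>\<^sub>0 'k) set
      \<Rightarrow> ('g \<times> 'g \<Rightarrow>\<^sub>0 'k) set" where
  "wedge_smult s c \<XX> = (\<Union>f\<in>\<XX>. wedge_rel s `` {free_scale c f})"

text \<open>
  The linear extension to the exterior square of an alternating bilinear map \<open>B\<close> into the space
  with scalar multiplication \<open>sw\<close>; by well-definedness (lemma \<open>wedge_lift_class\<close>) the image of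
  a coset is a singleton.
\<close>

definition free_lift ::
    "('k::field \<Rightarrow> 'w::ab_group_add \<Rightarrow> 'w) \<Rightarrow> ('g \<Rightarrow> 'g \<Rightarrow> 'w) \<Rightarrow> ('g \<times> 'g \<Rightarrow>\<^sub>0 'k) \<Rightarrow> 'w" where
  "free_lift sw B f =
     (\<Sum>p\<in>Poly_Mapping.keys f. sw (Poly_Mapping.lookup f p) (B (fst p) (snd p)))"

definition wedge_lift ::
    "('k::field \<Rightarrow> 'w::ab_group_add \<Rightarrow> 'w) \<Rightarrow> ('g \<Rightarrow> 'g \<Rightarrow> 'w) \<Rightarrow> ('g \<times> 'g \<Rightarrow>\<^sub>0 'k) set \<Rightarrow> 'w" where
  "wedge_lift sw B \<XX> = the_elem (free_lift sw B ` \<XX>)"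

lemma lookup_free_scale [simp]:
  "Poly_Mapping.lookup (free_scale c f) p = c * Poly_Mapping.lookup f p"
  by (simp add: free_scale_def Poly_Mapping.map.rep_eq when_def)

lemma vector_space_free_scale: "Vector_Spaces.vector_space free_scale"
  by unfold_locales (auto intro!: poly_mapping_eqI simp: lookup_add algebra_simps)

lemma equiv_wedge_rel:
  fixes s :: "'k::field \<Rightarrow> 'g::ab_group_add \<Rightarrow> 'g"
  shows "equiv UNIV (wedge_rel s)"
proof -
  interpret F: Vector_Spaces.vector_space "free_scale :: 'k \<Rightarrow> ('g \<times> 'g \<Rightarrow>\<^sub>0 'k) \<Rightarrow> _"
    by (rule vector_space_free_scale)
  show ?thesis
  proof (rule equivI)
    show "refl (wedge_rel s)"
      by (auto simp: refl_on_def wedge_rel_def F.span_zero)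
    show "sym (wedge_rel s)"
    proof (rule symI)
      fix f g assume "(f, g) \<in> wedge_rel s"
      then have "- (f - g) \<in> F.span (wedge_relators s)"
        unfolding wedge_rel_def by (intro F.span_neg) auto
      then show "(g, f) \<in> wedge_rel s" by (simp add: wedge_rel_def)
    qed
    show "trans (wedge_rel s)"
    proof (rule transI)
      fix f g h assume "(f, g) \<in> wedge_rel s" "(g, h) \<in> wedge_rel s"
      then have "(f - g) + (g - h) \<in> F.span (wedge_relators s)"
        unfolding wedge_rel_def by (intro F.span_add) auto
      then show "(f, h) \<in> wedge_rel s" by (simp add: wedge_rel_def)
    qed
  qed auto
qed

lemma free_lift_superset:
  assumes "Vector_Spaces.vector_space sw" "finite A" "Poly_Mapping.keys f \<subseteq> A"
  shows "free_lift sw B f = (\<Sum>p\<in>A. sw (Poly_Mapping.lookup f p) (B (fst p) (snd p)))"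
proof -
  interpret W: Vector_Spaces.vector_space sw by fact
  show ?thesis unfolding free_lift_def
    by (rule sum.mono_neutral_left) (use assms in \<open>auto simp: in_keys_iff\<close>)
qed

lemma linear_free_lift:
  fixes sw :: "'k::field \<Rightarrow> 'w::ab_group_add \<Rightarrow> 'w" and B :: "'g \<Rightarrow> 'g \<Rightarrow> 'w"
  assumes "Vector_Spaces.vector_space sw"
  shows "Vector_Spaces.linear free_scale sw (free_lift sw B)"
proof -
  interpret W: Vector_Spaces.vector_space sw by fact
  interpret F: Vector_Spaces.vector_space "free_scale :: 'k \<Rightarrow> ('g \<times> 'g \<Rightarrow>\<^sub>0 'k) \<Rightarrow> _"
    by (rule vector_space_free_scale)
  show ?thesis
  proof unfold_locales
    fix f g :: "'g \<times> 'g \<Rightarrow>\<^sub>0 'k" and c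
    let ?A = "Poly_Mapping.keys f \<union> Poly_Mapping.keys g"
    have "free_lift sw B h = (\<Sum>p\<in>?A. sw (Poly_Mapping.lookup h p) (B (fst p) (snd p)))"
      if "Poly_Mapping.keys h \<subseteq> ?A" for h
      by (rule free_lift_superset) (use assms that in auto)
    note * = this
    show "free_lift sw B (f + g) = free_lift sw B f + free_lift sw B g"
      using *[of f] *[of g] *[of "f + g"] keys_add[of f g]
      by (simp add: lookup_add W.scale_left_distrib sum.distrib)
    have "Poly_Mapping.keys (free_scale c f) \<subseteq> ?A"
      by (auto simp: in_keys_iff)
    then show "free_lift sw B (free_scale c f) = sw c (free_lift sw B f)"
      using *[of f] *[of "free_scale c f"] by (simp add: W.scale_sum_right)
  qed
qed

lemma free_lift_single:
  assumes "Vector_Spaces.vector_space sw"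
  shows "free_lift sw B (Poly_Mapping.single (x, y) c) = sw c (B x y)"
proof -
  interpret W: Vector_Spaces.vector_space sw by fact
  show ?thesis by (subst free_lift_superset[OF assms, of "{(x, y)}"]) auto
qed

lemma wedge_lift_class:
  assumes lin1: "\<And>y. Vector_Spaces.linear s sw (\<lambda>x. B x y)"
    and lin2: "\<And>x. Vector_Spaces.linear s sw (\<lambda>y. B x y)"
    and alt: "\<And>x. B x x = 0"
  shows "wedge_lift sw B (wedge_rel s `` {f}) = free_lift sw B f"
proof -
  interpret L1: Vector_Spaces.linear s sw "\<lambda>x. B x y" for y by (rule lin1)
  interpret L2: Vector_Spaces.linear s sw "\<lambda>y. B x y" for x by (rule lin2)
  have sw: "Vector_Spaces.vector_space sw" by (rule L1.vs2.vector_space_axioms)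
  interpret L: Vector_Spaces.linear free_scale sw "free_lift sw B"
    by (rule linear_free_lift[OF sw])
  have rel0: "free_lift sw B r = 0" if "r \<in> wedge_relators s" for r
    using that unfolding wedge_relators_def Let_def
    by (auto simp: L.diff L.scale free_lift_single[OF sw] alt L1.add L2.add L1.scale L2.scale)
  have span0: "free_lift sw B r = 0" if "r \<in> L.vs1.span (wedge_relators s)" for r
    using that by (induction rule: L.vs1.span_induct_alt) (auto simp: L.add L.scale rel0)
  have "free_lift sw B g = free_lift sw B f" if "(f, g) \<in> wedge_rel s" for g
    using span0[of "f - g"] that by (simp add: wedge_rel_def L.diff)
  moreover have "(f, f) \<in> wedge_rel s"
    by (simp add: wedge_rel_def L.vs1.span_zero)
  ultimately have "free_lift sw B ` (wedge_rel s `` {f}) = {free_lift sw B f}"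
    by blast
  then show ?thesis by (simp add: wedge_lift_def)
qed

lemma wedge_lift_wedge:
  assumes "\<And>y. Vector_Spaces.linear s sw (\<lambda>x. B x y)"
    and "\<And>x. Vector_Spaces.linear s sw (\<lambda>y. B x y)"
    and "\<And>x. B x x = 0"
  shows "wedge_lift sw B (wedge s x y) = B x y"
proof -
  interpret L1: Vector_Spaces.linear s sw "\<lambda>x. B x y" for y by (rule assms)
  show ?thesis
    unfolding wedge_def
    by (subst wedge_lift_class[OF assms])
      (simp_all add: free_lift_single[OF L1.vs2.vector_space_axioms])
qed

subsection \<open>The cochain spaces and the differential\<close>

definition br_T ::
    "('g \<Rightarrow> 'g \<Rightarrow> 'v \<Rightarrow> 'v) \<Rightarrow> ('v \<Rightarrow> 'g) \<Rightarrow> 'v \<Rightarrow> 'v \<Rightarrow> 'v \<Rightarrow> 'v" where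
  "br_T rho T u v w = rho (T u) (T v) w"

definition l_T :: "('g \<Rightarrow> 'g \<Rightarrow> 'g \<Rightarrow> 'g) \<Rightarrow> ('v \<Rightarrow> 'g) \<Rightarrow> 'v \<Rightarrow> 'v \<Rightarrow> 'g \<Rightarrow> 'g" where
  "l_T br T u v x = br (T u) (T v) x"

definition m_T ::
    "('g::ab_group_add \<Rightarrow> 'g \<Rightarrow> 'g \<Rightarrow> 'g) \<Rightarrow> ('g \<Rightarrow> 'g \<Rightarrow> 'v \<Rightarrow> 'v) \<Rightarrow> ('v \<Rightarrow> 'g)
      \<Rightarrow> 'v \<Rightarrow> 'v \<Rightarrow> 'g \<Rightarrow> 'g" where
  "m_T br rho T u v x = br (T u) x (T v) - T (rho (T u) x v)"

definition r_T ::
    "('g::ab_group_add \<Rightarrow> 'g \<Rightarrow> 'g \<Rightarrow> 'g) \<Rightarrow> ('g \<Rightarrow> 'g \<Rightarrow> 'v \<Rightarrow> 'v) \<Rightarrow> ('v \<Rightarrow> 'g)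
      \<Rightarrow> 'v \<Rightarrow> 'v \<Rightarrow> 'g \<Rightarrow> 'g" where
  "r_T br rho T u v x = - m_T br rho T u v x"

text \<open>
  A cochain \<open>\<theta>\<close> of degree \<open>n \<ge> 1\<close> is a map in \<open>2 n - 1\<close> vector variables, linear in each. The
  value $\theta(u_1 \otimes v_1, \dots, u_{n-1} \otimes v_{n-1}, w)$ is written
  \<open>\<theta> [(u\<^sub>1, v\<^sub>1), \<dots>, (u\<^sub>n\<^sub>-\<^sub>1, v\<^sub>n\<^sub>-\<^sub>1)] w\<close>. On lists of any other length \<open>\<theta>\<close> is normalised to
  zero, so that equality of cochains is equality of functions.
\<close>

type_synonym ('v, 'g) leib_cochain = "('v \<times> 'v) list \<Rightarrow> 'v \<Rightarrow> 'g"

definition C_3Leib ::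
    "('k::field \<Rightarrow> 'v::ab_group_add \<Rightarrow> 'v) \<Rightarrow> ('k \<Rightarrow> 'g::ab_group_add \<Rightarrow> 'g) \<Rightarrow> nat
      \<Rightarrow> ('v, 'g) leib_cochain set" where
  "C_3Leib sv sg n =
     {\<theta>. (\<forall>Us w. length Us \<noteq> n - 1 \<longrightarrow> \<theta> Us w = 0) \<and>
         (\<forall>Us. length Us = n - 1 \<longrightarrow>
            Vector_Spaces.linear sv sg (\<theta> Us) \<and>
            (\<forall>i<n - 1. \<forall>a w.
               Vector_Spaces.linear sv sg (\<lambda>u. \<theta> (Us[i := (u, a)]) w) \<and>
               Vector_Spaces.linear sv sg (\<lambda>v. \<theta> (Us[i := (a, v)]) w)))}"

text \<open>
  List positions count from 0, the indices \<open>j\<close>, \<open>k\<close> of the formula from 1. As \<open>j < k\<close>,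
  replacing the \<open>k\<close>-th entry and then omitting the \<open>j\<close>-th one gives the arguments of the
  double sums.
\<close>

definition omit :: "nat \<Rightarrow> 'a list \<Rightarrow> 'a list" where
  "omit j xs = take (j - 1) xs @ drop j xs"

definition partial_T ::
    "('k::field \<Rightarrow> 'g::ab_group_add \<Rightarrow> 'g) \<Rightarrow> ('g \<Rightarrow> 'g \<Rightarrow> 'g \<Rightarrow> 'g)
      \<Rightarrow> ('g \<Rightarrow> 'g \<Rightarrow> 'v \<Rightarrow> 'v) \<Rightarrow> ('v \<Rightarrow> 'g) \<Rightarrow> nat
      \<Rightarrow> ('v, 'g) leib_cochain \<Rightarrow> ('v, 'g) leib_cochain" where
  "partial_T sg br rho T n \<theta> Us w =
     (if length Us \<noteq> n then 0 else
       let u = (\<lambda>j. fst (Us ! (j - 1))); v = (\<lambda>j. snd (Us ! (j - 1))) in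
         (\<Sum>k=1..n. \<Sum>j=1..<k.
            sg ((- 1) ^ j) (\<theta> (omit j (Us[k - 1 := (br_T rho T (u j) (v j) (u k), v k)])) w))
       + (\<Sum>k=1..n. \<Sum>j=1..<k.
            sg ((- 1) ^ j) (\<theta> (omit j (Us[k - 1 := (u k, br_T rho T (u j) (v j) (v k))])) w))
       + (\<Sum>j=1..n.
            sg ((- 1) ^ j) (\<theta> (omit j Us) (br_T rho T (u j) (v j) w))
          + sg ((- 1) ^ (j + 1)) (l_T br T (u j) (v j) (\<theta> (omit j Us) w)))
       + sg ((- 1) ^ (n + 1))
           (m_T br rho T (u n) w (\<theta> (butlast Us) (v n))
          + r_T br rho T (v n) w (\<theta> (butlast Us) (u n))))"

definition delta_T ::
    "('k::field \<Rightarrow> 'g::ab_group_add \<Rightarrow> 'g) \<Rightarrow> ('g \<Rightarrow> 'g \<Rightarrow> 'g \<Rightarrow> 'g)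
      \<Rightarrow> ('k \<Rightarrow> 'v::ab_group_add \<Rightarrow> 'v) \<Rightarrow> ('g \<Rightarrow> 'g \<Rightarrow> 'v \<Rightarrow> 'v) \<Rightarrow> ('v \<Rightarrow> 'g)
      \<Rightarrow> ('g \<times> 'g \<Rightarrow>\<^sub>0 'k) set \<Rightarrow> 'v \<Rightarrow> 'g" where
  "delta_T sg br sv rho T \<XX> v =
     T (wedge_lift sv (\<lambda>x y. rho x y v) \<XX>) - wedge_lift sg (\<lambda>x y. br x y (T v)) \<XX>"

text \<open>
  Cochains of all degrees in one type: \<open>Ext\<close> for degree 1, \<open>Leib\<close> for degrees \<open>k \<ge> 2\<close>.
\<close>

datatype ('e, 'l) cochain_sum = Ext 'e | Leib 'l

type_synonym ('k, 'g, 'v) cochain =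
  "(('g \<times> 'g \<Rightarrow>\<^sub>0 'k) set, ('v, 'g) leib_cochain) cochain_sum"

fun cochain_add ::
    "('k::field \<Rightarrow> 'g::ab_group_add \<Rightarrow> 'g) \<Rightarrow> ('k, 'g, 'v) cochain \<Rightarrow> ('k, 'g, 'v) cochain
      \<Rightarrow> ('k, 'g, 'v) cochain" where
  "cochain_add sg (Ext \<XX>) (Ext \<YY>) = Ext (wedge_add sg \<XX> \<YY>)"
| "cochain_add sg (Leib \<theta>) (Leib \<eta>) = Leib (\<lambda>Us w. \<theta> Us w + \<eta> Us w)"
| "cochain_add sg _ _ = undefined"

fun cochain_smult ::
    "('k::field \<Rightarrow> 'g::ab_group_add \<Rightarrow> 'g) \<Rightarrow> 'k \<Rightarrow> ('k, 'g, 'v) cochain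
      \<Rightarrow> ('k, 'g, 'v) cochain" where
  "cochain_smult sg c (Ext \<XX>) = Ext (wedge_smult sg c \<XX>)"
| "cochain_smult sg c (Leib \<theta>) = Leib (\<lambda>Us w. sg c (\<theta> Us w))"

text \<open>
  The fields \<open>mult\<close> and \<open>one\<close> are inherited from the ring record and play no role in a module.
  Degrees start at 1; the value at 0 is irrelevant.
\<close>

definition C_T ::
    "('k::field \<Rightarrow> 'g::ab_group_add \<Rightarrow> 'g) \<Rightarrow> ('k \<Rightarrow> 'v::ab_group_add \<Rightarrow> 'v) \<Rightarrow> nat
      \<Rightarrow> ('k, ('k, 'g, 'v) cochain) module" where
  "C_T sg sv k =
     \<lparr>carrier = (if k = 1 then Ext ` exterior_square sg else Leib ` C_3Leib sv sg (k - 1)),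
      monoid.mult = undefined, one = undefined,
      ring.zero = (if k = 1 then Ext (wedge_zero sg) else Leib (\<lambda>_ _. 0)),
      add = cochain_add sg, module.smult = cochain_smult sg\<rparr>"

text \<open>A linear map \<open>V \<rightarrow> g\<close> is a cochain in \<open>C_3Leib\<close> of degree 1, evaluated at the empty list.\<close>

fun d_T ::
    "('k::field \<Rightarrow> 'g::ab_group_add \<Rightarrow> 'g) \<Rightarrow> ('g \<Rightarrow> 'g \<Rightarrow> 'g \<Rightarrow> 'g)
      \<Rightarrow> ('k \<Rightarrow> 'v::ab_group_add \<Rightarrow> 'v) \<Rightarrow> ('g \<Rightarrow> 'g \<Rightarrow> 'v \<Rightarrow> 'v) \<Rightarrow> ('v \<Rightarrow> 'g) \<Rightarrow> nat
      \<Rightarrow> ('k, 'g, 'v) cochain \<Rightarrow> ('k, 'g, 'v) cochain" where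
  "d_T sg br sv rho T k (Ext \<XX>) =
     Leib (\<lambda>Us v. if Us = [] then delta_T sg br sv rho T \<XX> v else 0)"
| "d_T sg br sv rho T k (Leib \<theta>) = Leib (partial_T sg br rho T (k - 1) \<theta>)"

subsection \<open>Cochain complexes\<close>

definition module_maps :: "'k ring \<Rightarrow> ('k, 'a) module \<Rightarrow> ('k, 'b) module \<Rightarrow> ('a \<Rightarrow> 'b) set" where
  "module_maps R M N =
     {f \<in> carrier M \<rightarrow> carrier N.
        (\<forall>x\<in>carrier M. \<forall>y\<in>carrier M. f (x \<oplus>\<^bsub>M\<^esub> y) = f x \<oplus>\<^bsub>N\<^esub> f y) \<and>
        (\<forall>c\<in>carrier R. \<forall>x\<in>carrier M. f (c \<odot>\<^bsub>M\<^esub> x) = c \<odot>\<^bsub>N\<^esub> f x)}"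

text \<open>
  A cochain complex on the graded module $\bigoplus_{k \ge 1} C^k$, given by its homogeneous
  components: linear maps of degree one with square zero.
\<close>

definition cochain_complex ::
    "'k ring \<Rightarrow> (nat \<Rightarrow> ('k, 'c) module) \<Rightarrow> (nat \<Rightarrow> 'c \<Rightarrow> 'c) \<Rightarrow> bool" where
  "cochain_complex R C d \<longleftrightarrow>
     (\<forall>k\<ge>1. Module.module R (C k) \<and> d k \<in> module_maps R (C k) (C (k + 1))) \<and>
     (\<forall>k\<ge>1. \<forall>x\<in>carrier (C k). d (k + 1) (d k x) = \<zero>\<^bsub>C (k + 2)\<^esub>)"

end

theory Submission
  imports Defs
begin

text \<open>
  The bracket \<open>[u,v,w]\<^sub>T = \<rho>(Tu,Tv)w\<close> makes \<open>V \<otimes> V\<close> a left Leibniz algebra acting on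
  \<open>Hom(V,g)\<close>, and \<open>\<partial>\<^sub>T\<close> is the corresponding Loday-Pirashvili coboundary. Its square vanishes by a
  Cartan calculus. Write \<open>\<iota>\<^sub>U\<close> for the insertion of \<open>U = u \<otimes> v\<close> as first argument, \<open>L\<^sub>U\<close> for the
  Lie derivative along \<open>U\<close>, and \<open>R\<^sub>U \<phi> = m\<^sub>T(u,\<cdot>) \<phi>(v) + r\<^sub>T(v,\<cdot>) \<phi>(u)\<close> for the action
  of \<open>m\<^sub>T\<close> and \<open>r\<^sub>T\<close> on linear maps \<open>\<phi>\<close>. Then
  \<open>\<iota>\<^sub>U \<partial>\<theta> = L\<^sub>U \<theta> - \<partial> \<iota>\<^sub>U \<theta> + R\<^sub>U \<theta>\<close>, where the last term is present only if \<open>\<theta>\<close> is itself a linear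
  map \<open>V \<rightarrow> g\<close>. This identity serves as a recursive definition of \<open>\<partial>\<close> on lists of arguments, and
  lemma \<open>partial_T_eq_coboundary\<close> identifies the result with the explicit alternating sum.

  The recursion turns both \<open>L\<^sub>U \<partial> = \<partial> L\<^sub>U\<close> (lemma \<open>lie_coboundary\<close>) and \<open>\<partial>\<partial> = 0\<close>
  (lemma \<open>coboundary_coboundary\<close>) into inductions on the list of arguments. For the second, applying
  the identity twice gives
  \<open>\<iota>\<^sub>U \<partial>\<partial>\<theta> = (L\<^sub>U \<partial> - \<partial> L\<^sub>U)\<theta> + \<partial>\<partial> \<iota>\<^sub>U \<theta> - \<partial> R\<^sub>U \<theta>\<close>,
  in which the first two terms vanish by the commutation rule and by induction.

  The remaining term is where degree one enters. Up to sign \<open>R\<^sub>U \<theta>\<close> is \<open>\<delta>\<close> of the bivector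
  \<open>Tu \<and> \<theta>(v) + \<theta>(u) \<and> Tv\<close>, so it is killed by \<open>\<partial>\<close> for the same reason that \<open>\<partial>\<delta> = 0\<close>:
  moving \<open>T\<close> by the inner derivations \<open>[x,y,\<cdot>]\<close> of \<open>g\<close> and \<open>\<rho>(x,y)\<close> of \<open>V\<close> preserves the
  embedding equation to first order (lemma \<open>inner_cocycle\<close>).
\<close>

section \<open>The exterior square as a module\<close>

lemma wedge_add_class:
  fixes s :: "'k::field \<Rightarrow> 'g::ab_group_add \<Rightarrow> 'g"
  shows "wedge_add s (wedge_rel s `` {f}) (wedge_rel s `` {g}) = wedge_rel s `` {f + g}"
proof -
  interpret F: Vector_Spaces.vector_space "free_scale :: 'k \<Rightarrow> ('g \<times> 'g \<Rightarrow>\<^sub>0 'k) \<Rightarrow> _"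
    by (rule vector_space_free_scale)
  have "congruent2 (wedge_rel s) (wedge_rel s) (\<lambda>f g. wedge_rel s `` {f + g})"
  proof (rule congruent2I')
    fix f f' g g' assume "(f, f') \<in> wedge_rel s" "(g, g') \<in> wedge_rel s"
    then have "(f - f') + (g - g') \<in> F.span (wedge_relators s)"
      unfolding wedge_rel_def by (intro F.span_add) auto
    then have "(f + g, f' + g') \<in> wedge_rel s"
      by (simp add: wedge_rel_def algebra_simps)
    then show "wedge_rel s `` {f + g} = wedge_rel s `` {f' + g'}"
      by (rule equiv_class_eq[OF equiv_wedge_rel])
  qed
  then show ?thesis
    unfolding wedge_add_def by (intro UN_equiv_class2[OF equiv_wedge_rel equiv_wedge_rel]) auto
qed

lemma wedge_smult_class:
  fixes s :: "'k::field \<Rightarrow> 'g::ab_group_add \<Rightarrow> 'g"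
  shows "wedge_smult s c (wedge_rel s `` {f}) = wedge_rel s `` {free_scale c f}"
proof -
  interpret F: Vector_Spaces.vector_space "free_scale :: 'k \<Rightarrow> ('g \<times> 'g \<Rightarrow>\<^sub>0 'k) \<Rightarrow> _"
    by (rule vector_space_free_scale)
  have "(\<lambda>f. wedge_rel s `` {free_scale c f}) respects wedge_rel s"
  proof (rule congruentI)
    fix f f' assume "(f, f') \<in> wedge_rel s"
    then have "free_scale c (f - f') \<in> F.span (wedge_relators s)"
      unfolding wedge_rel_def by (intro F.span_scale) auto
    then have "(free_scale c f, free_scale c f') \<in> wedge_rel s"
      by (simp add: wedge_rel_def F.scale_right_diff_distrib)
    then show "wedge_rel s `` {free_scale c f} = wedge_rel s `` {free_scale c f'}"
      by (rule equiv_class_eq[OF equiv_wedge_rel])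
  qed
  then show ?thesis
    unfolding wedge_smult_def by (intro UN_equiv_class[OF equiv_wedge_rel]) auto
qed

lemma exterior_square_iff: "\<XX> \<in> exterior_square s \<longleftrightarrow> (\<exists>f. \<XX> = wedge_rel s `` {f})"
  by (auto simp: exterior_square_def quotient_def)

lemma C_T_simps:
  "add (C_T sg sv k) = cochain_add sg"
  "module.smult (C_T sg sv k) = cochain_smult sg"
  "\<zero>\<^bsub>C_T sg sv (Suc 0)\<^esub> = Ext (wedge_zero sg)"
  "\<zero>\<^bsub>C_T sg sv (Suc (Suc n))\<^esub> = Leib (\<lambda>_ _. 0)"
  by (simp_all add: C_T_def)

lemma ring_of_type_algebra_simps:
  "carrier ring_of_type_algebra = UNIV"
  "\<one>\<^bsub>ring_of_type_algebra\<^esub> = 1"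
  "add ring_of_type_algebra = (+)"
  "monoid.mult ring_of_type_algebra = (*)"
  by (simp_all add: ring_of_type_algebra_def)

lemma carrier_C_T_1: "x \<in> carrier (C_T sg sv (Suc 0)) \<longleftrightarrow> (\<exists>f. x = Ext (wedge_rel sg `` {f}))"
  by (auto simp: C_T_def image_iff exterior_square_iff)

lemma module_exterior_square:
  fixes sg :: "'k::field \<Rightarrow> 'g::ab_group_add \<Rightarrow> 'g" and sv :: "'k \<Rightarrow> 'v::ab_group_add \<Rightarrow> 'v"
  shows "Module.module ring_of_type_algebra (C_T sg sv (Suc 0))"
proof -
  interpret F: Vector_Spaces.vector_space "free_scale :: 'k \<Rightarrow> ('g \<times> 'g \<Rightarrow>\<^sub>0 'k) \<Rightarrow> _"
    by (rule vector_space_free_scale)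
  have inverse: "\<exists>g. wedge_rel sg `` {g + f} = wedge_rel sg `` {0}" for f
    by (rule exI[of _ "- f"]) simp
  show ?thesis
  proof (rule moduleI)
    show "abelian_group (C_T sg sv (Suc 0))"
    proof (rule abelian_groupI)
      fix x assume "x \<in> carrier (C_T sg sv (Suc 0))"
      then obtain f where "x = Ext (wedge_rel sg `` {f})" unfolding carrier_C_T_1 ..
      with inverse[of f] show "\<exists>y\<in>carrier (C_T sg sv (Suc 0)).
          y \<oplus>\<^bsub>C_T sg sv (Suc 0)\<^esub> x = \<zero>\<^bsub>C_T sg sv (Suc 0)\<^esub>"
        unfolding Bex_def carrier_C_T_1 by (auto simp: C_T_simps wedge_add_class wedge_zero_def)
    qed (auto simp: carrier_C_T_1 C_T_simps wedge_add_class wedge_zero_def ac_simps)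
    show "cring (ring_of_type_algebra :: 'k ring)" by (rule cring_from_type_algebra)
  qed (auto simp: carrier_C_T_1 C_T_simps wedge_add_class wedge_smult_class
      ring_of_type_algebra_simps F.scale_left_distrib F.scale_right_distrib)
qed

context embedding_tensor
begin

\<comment> \<open>Universal statements about an element \<open>U\<close> of \<open>V \<times> V\<close> must match as rewrite rules for \<open>U\<close> not
  given as a pair.\<close>
declare split_paired_All [simp del]

section \<open>Consequences of multilinearity\<close>

lemma br_add: "br (x + x') y z = br x y z + br x' y z" "br x (y + y') z = br x y z + br x y' z"
  "br x y (z + z') = br x y z + br x y z'"
  using br_linear1 br_linear2 br_linear3 by (simp_all add: Vector_Spaces.linear_iff)

lemma br_scale: "br (sg c x) y z = sg c (br x y z)" "br x (sg c y) z = sg c (br x y z)"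
  "br x y (sg c z) = sg c (br x y z)"
  using br_linear1 br_linear2 br_linear3 by (simp_all add: Vector_Spaces.linear_iff)

lemma rho_add: "rho (x + x') y v = rho x y v + rho x' y v" "rho x (y + y') v = rho x y v + rho x y' v"
  "rho x y (v + v') = rho x y v + rho x y v'"
  using rho_linear1 rho_linear2 rho_linear3 by (simp_all add: Vector_Spaces.linear_iff)

lemma rho_scale: "rho (sg c x) y v = sv c (rho x y v)" "rho x (sg c y) v = sv c (rho x y v)"
  "rho x y (sv c v) = sv c (rho x y v)"
  using rho_linear1 rho_linear2 rho_linear3 by (simp_all add: Vector_Spaces.linear_iff)

lemma T_add: "T (u + v) = T u + T v" and T_scale: "T (sv c v) = sg c (T v)"
  using T_linear by (simp_all add: Vector_Spaces.linear_iff)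

lemma br_zero: "br 0 y z = 0" "br x 0 z = 0" "br x y 0 = 0"
  using br_add(1)[of 0 0 y z] br_add(2)[of x 0 0 z] br_add(3)[of x y 0 0] by simp_all

lemma rho_zero: "rho 0 y z = 0" "rho x 0 z = 0" "rho x y 0 = 0"
  using rho_add(1)[of 0 0 y z] rho_add(2)[of x 0 0 z] rho_add(3)[of x y 0 0] by simp_all

lemma T_zero: "T 0 = 0"
  using T_add[of 0 0] by simp

lemma br_minus: "br (- x) y z = - br x y z" "br x (- y) z = - br x y z" "br x y (- z) = - br x y z"
  using br_add(1)[of x "-x" y z] br_add(2)[of x y "-y" z] br_add(3)[of x y z "-z"]
  by (simp_all add: br_zero eq_neg_iff_add_eq_0 add.commute)

lemma rho_minus: "rho (- x) y z = - rho x y z" "rho x (- y) z = - rho x y z" "rho x y (- z) = - rho x y z"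
  using rho_add(1)[of x "-x" y z] rho_add(2)[of x y "-y" z] rho_add(3)[of x y z "-z"]
  by (simp_all add: rho_zero eq_neg_iff_add_eq_0 add.commute)

lemma T_minus: "T (- x) = - T x"
  using T_add[of x "-x"] by (simp add: T_zero eq_neg_iff_add_eq_0 add.commute)

lemma br_diff: "br (x - x') y z = br x y z - br x' y z" "br x (y - y') z = br x y z - br x y' z"
  "br x y (z - z') = br x y z - br x y z'"
  by (simp_all only: diff_conv_add_uminus br_add br_minus)

lemma rho_diff: "rho (x - x') y z = rho x y z - rho x' y z" "rho x (y - y') z = rho x y z - rho x y' z"
  "rho x y (z - z') = rho x y z - rho x y z'"
  by (simp_all only: diff_conv_add_uminus rho_add rho_minus)

lemma T_diff: "T (x - y) = T x - T y"
  by (simp_all only: diff_conv_add_uminus T_add T_minus)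

lemmas additivity = br_add br_diff br_minus br_zero rho_add rho_diff rho_minus rho_zero
  T_add T_diff T_minus T_zero
lemmas homogeneity = br_scale rho_scale T_scale

lemma rho_skew: "rho y x v = - rho x y v"
proof -
  have "rho x y v + rho y x v = rho (x + y) (x + y) v"
    by (simp only: rho_add) (simp add: rho_alternating)
  also have "\<dots> = 0" by (rule rho_alternating)
  finally show ?thesis by (simp add: eq_neg_iff_add_eq_0 add.commute)
qed

section \<open>The Leibniz action on linear maps and inner cocycles\<close>

abbreviation adT :: "'v \<times> 'v \<Rightarrow> 'g \<Rightarrow> 'g" where
  "adT U x \<equiv> br (T (fst U)) (T (snd U)) x"

abbreviation rhoT :: "'v \<times> 'v \<Rightarrow> 'v \<Rightarrow> 'v" where
  "rhoT U w \<equiv> rho (T (fst U)) (T (snd U)) w"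

text \<open>
  The action of \<open>V \<otimes> V\<close> on \<open>Hom(V,g)\<close> that comes from \<open>l\<^sub>T\<close> and the bracket of \<open>V\<close>.
\<close>
definition left_action :: "'v \<times> 'v \<Rightarrow> ('v \<Rightarrow> 'g) \<Rightarrow> 'v \<Rightarrow> 'g" where
  "left_action U \<phi> w = adT U (\<phi> w) - \<phi> (rhoT U w)"

text \<open>This is \<open>- \<delta>(x \<and> y)\<close>.\<close>
definition inner :: "'g \<Rightarrow> 'g \<Rightarrow> 'v \<Rightarrow> 'g" where
  "inner x y w = br x y (T w) - T (rho x y w)"

text \<open>
  This is \<open>m\<^sub>T(u,w) \<phi>(v) + r\<^sub>T(v,w) \<phi>(u)\<close> for \<open>U = u \<otimes> v\<close>, because \<open>m\<^sub>T(u,w)x\<close> is the value of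
  \<open>inner (Tu) x\<close> at \<open>w\<close>. Written through \<open>inner\<close>, it is visibly in the image of \<open>\<delta>\<close>. In the
  Leibniz bimodule \<open>Hom(V,g)\<close> the right multiplication by \<open>U\<close> is, up to sign, the sum of
  \<open>left_action U\<close> and this map.
\<close>
definition mr_action :: "'v \<times> 'v \<Rightarrow> ('v \<Rightarrow> 'g) \<Rightarrow> 'v \<Rightarrow> 'g" where
  "mr_action U \<phi> w = inner (T (fst U)) (\<phi> (snd U)) w - inner (T (snd U)) (\<phi> (fst U)) w"

lemma T_rhoT: "T (rhoT U w) = adT U (T w)"
  by (simp add: T_embedding)

lemma inner_diff: "inner (x - x') y w = inner x y w - inner x' y w"
  "inner x (y - y') w = inner x y w - inner x y' w"
  by (simp_all add: inner_def additivity)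

text \<open>
  Equivariance of \<open>\<delta>\<close>: \<open>ad(Tu,Tv)\<close> and \<open>\<rho>(Tu,Tv)\<close> act as derivations on all structure maps and are
  intertwined by \<open>T\<close>.
\<close>
lemma left_action_inner:
  "left_action U (inner x y) w = inner (adT U x) y w + inner x (adT U y) w"
  unfolding left_action_def inner_def
  by (simp add: additivity T_rhoT[symmetric] fundamental_identity rho_comp[of "T (fst U)"])

text \<open>
  This is \<open>\<partial>\<delta> = 0\<close> on a decomposable bivector. The pair \<open>([x,y,\<cdot>], \<rho>(x,y))\<close> is a derivation of the
  representation, so \<open>\<delta>(x \<and> y)\<close> is a tangent vector at \<open>T\<close> to the solutions of the embedding
  equation, and the linearisation of that equation is the cocycle condition.
\<close>
lemma inner_cocycle: "left_action U (inner x y) w + mr_action U (inner x y) w = 0"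
proof -
  define u v where "u = fst U" and "v = snd U"
  have br_br: "br x y (br (T u) (T v) (T w)) =
      br (br x y (T u)) (T v) (T w) + br (T u) (br x y (T v)) (T w) + br (T u) (T v) (br x y (T w))"
    by (rule fundamental_identity)
  have rho_rho: "T (rho x y (rho (T u) (T v) w)) = T (rho (br x y (T u)) (T v) w)
     + T (rho (T u) (br x y (T v)) w) + br (T u) (T v) (T (rho x y w))"
    by (subst rho_comp) (simp add: additivity T_embedding)
  have act: "left_action U (inner x y) w =
      br (T u) (T v) (br x y (T w)) - br (T u) (T v) (T (rho x y w))
      - br x y (br (T u) (T v) (T w)) + T (rho x y (rho (T u) (T v) w))"
    by (simp add: left_action_def inner_def u_def v_def br_diff T_embedding)
  have right1: "inner (T u) (inner x y v) w = br (T u) (br x y (T v)) (T w) - T (rho (T u) (br x y (T v)) w)"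
    by (simp add: inner_def br_diff rho_diff T_diff T_embedding[symmetric])
  have "inner (T v) (inner x y u) w = br (T v) (br x y (T u)) (T w) - T (rho (T v) (br x y (T u)) w)"
    by (simp add: inner_def br_diff rho_diff T_diff T_embedding[symmetric])
  also have "\<dots> = - br (br x y (T u)) (T v) (T w) + T (rho (br x y (T u)) (T v) w)"
    by (simp only: br_skew12[of "T v"] rho_skew[of "T v"] T_minus diff_minus_eq_add)
  finally show ?thesis
    using right1 unfolding act mr_action_def u_def[symmetric] v_def[symmetric]
    by (simp add: br_br rho_rho)
qed

text \<open>
  The Leibniz bracket \<open>[u \<otimes> v, a \<otimes> b] = [u,v,a] \<otimes> b + a \<otimes> [u,v,b]\<close> is in general not decomposable; its two
  summands are kept apart, and formulas in \<open>[U,A]\<close> have one term for each.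
\<close>
abbreviation ad_fst :: "'v \<times> 'v \<Rightarrow> 'v \<times> 'v \<Rightarrow> 'v \<times> 'v" where
  "ad_fst U A \<equiv> (rhoT U (fst A), snd A)"

abbreviation ad_snd :: "'v \<times> 'v \<Rightarrow> 'v \<times> 'v \<Rightarrow> 'v \<times> 'v" where
  "ad_snd U A \<equiv> (fst A, rhoT U (snd A))"

lemma adT_comm: "adT U (adT A x) = adT (ad_fst U A) x + adT (ad_snd U A) x + adT A (adT U x)"
  by (subst fundamental_identity) (simp add: T_embedding)

lemma rhoT_comm: "rhoT U (rhoT A w) = rhoT (ad_fst U A) w + rhoT (ad_snd U A) w + rhoT A (rhoT U w)"
  by (subst rho_comp) (simp add: T_embedding)

abbreviation lin :: "('v \<Rightarrow> 'g) \<Rightarrow> bool" where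
  "lin \<phi> \<equiv> Vector_Spaces.linear sv sg \<phi>"

lemma lin_iff: "lin \<phi> \<longleftrightarrow> (\<forall>u v. \<phi> (u + v) = \<phi> u + \<phi> v) \<and> (\<forall>c v. \<phi> (sv c v) = sg c (\<phi> v))"
  by (simp add: Vector_Spaces.linear_iff V.vector_space_axioms vector_space_axioms)

lemma lin_zero: "lin (\<lambda>_. 0)"
  by (simp add: lin_iff)

lemma lin_plus: "lin \<phi> \<Longrightarrow> lin \<psi> \<Longrightarrow> lin (\<lambda>u. \<phi> u + \<psi> u)"
  by (simp add: lin_iff scale_right_distrib)

lemma lin_minus: "lin \<phi> \<Longrightarrow> lin \<psi> \<Longrightarrow> lin (\<lambda>u. \<phi> u - \<psi> u)"
  by (simp add: lin_iff scale_right_diff_distrib)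

lemma left_action_linear:
  "left_action U (\<lambda>w. \<phi> w + \<psi> w) w = left_action U \<phi> w + left_action U \<psi> w"
  "left_action U (\<lambda>w. \<phi> w - \<psi> w) w = left_action U \<phi> w - left_action U \<psi> w"
  "left_action U (\<lambda>w. sg c (\<phi> w)) w = sg c (left_action U \<phi> w)"
  "left_action U (\<lambda>w. 0) w = 0"
  by (simp_all add: left_action_def additivity homogeneity scale_right_diff_distrib)

lemma lin_scale: "lin \<phi> \<Longrightarrow> lin (\<lambda>u. sg c (\<phi> u))"
  by (simp add: lin_iff scale_right_distrib mult.commute)

lemma left_action_zero: "left_action U (\<lambda>_. 0) = (\<lambda>_. 0)"
  by (simp add: left_action_linear fun_eq_iff)

text \<open>
  The two bimodule axioms of \<open>Hom(V,g)\<close> that the Cartan calculus rests on: the left action represents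
  the Leibniz bracket, and it is a derivation of the action by \<open>m\<^sub>T\<close> and \<open>r\<^sub>T\<close>.
\<close>
lemma left_action_comm:
  assumes "lin \<phi>"
  shows "left_action U (left_action A \<phi>) w = left_action (ad_fst U A) \<phi> w + left_action (ad_snd U A) \<phi> w + left_action A (left_action U \<phi>) w"
proof -
  have "\<phi> (rhoT A (rhoT U w)) + \<phi> (rhoT (ad_fst U A) w) + \<phi> (rhoT (ad_snd U A) w) = \<phi> (rhoT U (rhoT A w))"
    using assms by (simp add: rhoT_comm[of U A w] lin_iff)
  then show ?thesis
    unfolding left_action_def br_diff adT_comm[of U A] by (simp add: algebra_simps)
qed

lemma left_action_right:
  "left_action U (mr_action A \<phi>) w = mr_action (ad_fst U A) \<phi> w + mr_action (ad_snd U A) \<phi> w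
    + mr_action A (left_action U \<phi>) w"
proof -
  have "mr_action A \<phi> = (\<lambda>w. inner (T (fst A)) (\<phi> (snd A)) w - inner (T (snd A)) (\<phi> (fst A)) w)"
    by (simp add: mr_action_def fun_eq_iff)
  then have "left_action U (mr_action A \<phi>) w =
      inner (adT U (T (fst A))) (\<phi> (snd A)) w + inner (T (fst A)) (adT U (\<phi> (snd A))) w
      - (inner (adT U (T (snd A))) (\<phi> (fst A)) w + inner (T (snd A)) (adT U (\<phi> (fst A))) w)"
    by (simp only: left_action_linear left_action_inner)
  then show ?thesis
    by (simp add: mr_action_def left_action_def[of U \<phi>] inner_diff T_rhoT)
qed

lemma lin_left_action: "lin \<phi> \<Longrightarrow> lin (left_action U \<phi>)"
  by (simp add: lin_iff left_action_def additivity homogeneity scale_right_diff_distrib)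

lemma lin_inner: "lin (inner x y)"
  by (simp add: lin_iff inner_def additivity homogeneity scale_right_diff_distrib)

lemma lin_mr_action: "lin (mr_action U \<phi>)"
  unfolding mr_action_def by (intro lin_minus lin_inner)

section \<open>The Cartan calculus\<close>

definition as_cochain :: "('v \<Rightarrow> 'g) \<Rightarrow> ('v, 'g) leib_cochain" where
  "as_cochain \<phi> = (\<lambda>Us w. if Us = [] then \<phi> w else 0)"

definition contract :: "'v \<times> 'v \<Rightarrow> ('v, 'g) leib_cochain \<Rightarrow> ('v, 'g) leib_cochain" where
  "contract U \<theta> = (\<lambda>Us. \<theta> (U # Us))"

text \<open>
  The equation for nonempty lists is the relation \<open>\<iota>\<^sub>A L\<^sub>U = L\<^sub>U \<iota>\<^sub>A - \<iota>\<^bsub>[U,A]\<^esub>\<close>; unfolded, it subtracts one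
  term for each argument in which \<open>U\<close> is bracketed (lemma \<open>lie_sum\<close>).
\<close>
fun lie :: "'v \<times> 'v \<Rightarrow> ('v, 'g) leib_cochain \<Rightarrow> ('v, 'g) leib_cochain" where
  "lie U \<theta> [] w = left_action U (\<theta> []) w"
| "lie U \<theta> (A # Us) w =
     lie U (contract A \<theta>) Us w - \<theta> (ad_fst U A # Us) w - \<theta> (ad_snd U A # Us) w"

text \<open>
  The Cartan formula as a recursion. The summand \<open>as_cochain\<close> is nonzero only at the end of
  the list, where \<open>mr_action\<close> appears. The signs of the alternating sum arise from the repeated
  subtraction, so the recursion is the same in all degrees.
\<close>
fun coboundary :: "('v, 'g) leib_cochain \<Rightarrow> ('v, 'g) leib_cochain" where
  "coboundary \<theta> [] w = 0"
| "coboundary \<theta> (U # Us) w =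
     lie U \<theta> Us w - coboundary (contract U \<theta>) Us w + as_cochain (mr_action U (\<theta> [])) Us w"

lemma Nil_eqs: "lie U \<theta> [] = left_action U (\<theta> [])" "coboundary \<theta> [] = (\<lambda>_. 0)" "as_cochain \<phi> [] = \<phi>"
  by (auto simp: as_cochain_def)

lemma contract_as_cochain: "contract A (as_cochain \<phi>) = (\<lambda>_ _. 0)"
  by (simp add: contract_def as_cochain_def)

lemma contract_lie:
  "contract A (lie U \<theta>) =
    (\<lambda>Us w. lie U (contract A \<theta>) Us w - contract (ad_fst U A) \<theta> Us w - contract (ad_snd U A) \<theta> Us w)"
  by (simp add: contract_def fun_eq_iff)

lemma contract_coboundary:
  "contract U (coboundary \<theta>) =
    (\<lambda>Us w. lie U \<theta> Us w - coboundary (contract U \<theta>) Us w + as_cochain (mr_action U (\<theta> [])) Us w)"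
  by (simp add: contract_def fun_eq_iff)

lemma contract_linear:
  "contract A (\<lambda>Us w. \<theta> Us w + \<eta> Us w) = (\<lambda>Us w. contract A \<theta> Us w + contract A \<eta> Us w)"
  "contract A (\<lambda>Us w. \<theta> Us w - \<eta> Us w) = (\<lambda>Us w. contract A \<theta> Us w - contract A \<eta> Us w)"
  "contract A (\<lambda>Us w. sg c (\<theta> Us w)) = (\<lambda>Us w. sg c (contract A \<theta> Us w))"
  "contract A (\<lambda>_ _. 0) = (\<lambda>_ _. 0)"
  by (simp_all add: contract_def)

lemma mr_action_linear:
  "mr_action U (\<lambda>w. \<phi> w + \<psi> w) w = mr_action U \<phi> w + mr_action U \<psi> w"
  "mr_action U (\<lambda>w. \<phi> w - \<psi> w) w = mr_action U \<phi> w - mr_action U \<psi> w"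
  "mr_action U (\<lambda>w. sg c (\<phi> w)) w = sg c (mr_action U \<phi> w)"
  "mr_action U (\<lambda>w. 0) w = 0"
  by (simp_all add: mr_action_def inner_def additivity homogeneity scale_right_diff_distrib)

lemma lie_linear:
  "lie U (\<lambda>Us w. \<theta> Us w + \<eta> Us w) Us w = lie U \<theta> Us w + lie U \<eta> Us w"
  "lie U (\<lambda>Us w. \<theta> Us w - \<eta> Us w) Us w = lie U \<theta> Us w - lie U \<eta> Us w"
  "lie U (\<lambda>Us w. sg c (\<theta> Us w)) Us w = sg c (lie U \<theta> Us w)"
  "lie U (\<lambda>_ _. 0) Us w = 0"
  by (induction Us arbitrary: \<theta> \<eta>)
    (simp_all add: left_action_linear contract_linear scale_right_diff_distrib)

lemma lie_zero: "lie U (\<lambda>_ _. 0) = (\<lambda>_ _. 0)"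
  by (simp add: lie_linear fun_eq_iff)

lemma coboundary_linear:
  "coboundary (\<lambda>Us w. \<theta> Us w + \<eta> Us w) Us w = coboundary \<theta> Us w + coboundary \<eta> Us w"
  "coboundary (\<lambda>Us w. \<theta> Us w - \<eta> Us w) Us w = coboundary \<theta> Us w - coboundary \<eta> Us w"
  "coboundary (\<lambda>Us w. sg c (\<theta> Us w)) Us w = sg c (coboundary \<theta> Us w)"
  "coboundary (\<lambda>_ _. 0) Us w = 0"
  by (induction Us arbitrary: \<theta> \<eta>)
    (simp_all add: contract_linear lie_linear mr_action_linear as_cochain_def
      scale_right_diff_distrib scale_right_distrib)

section \<open>Multilinear cochains\<close>

text \<open>
  A reformulation of membership in \<open>C_3Leib\<close> that recurses on the degree by contraction, as the Cartan
  calculus does. Since cochains vanish on lists of the wrong length, linearity in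
  the first slot can be required for all lists.
\<close>
fun multilinear :: "nat \<Rightarrow> ('v, 'g) leib_cochain \<Rightarrow> bool" where
  "multilinear 0 \<theta> \<longleftrightarrow> lin (\<theta> []) \<and> (\<forall>U. contract U \<theta> = (\<lambda>_ _. 0))"
| "multilinear (Suc n) \<theta> \<longleftrightarrow> \<theta> [] = (\<lambda>_. 0) \<and> (\<forall>U. multilinear n (contract U \<theta>)) \<and>
    (\<forall>a Us w. lin (\<lambda>u. \<theta> ((u, a) # Us) w) \<and> lin (\<lambda>v. \<theta> ((a, v) # Us) w))"

lemma multilinear_Nil: "multilinear n \<theta> \<Longrightarrow> lin (\<theta> [])"
  by (cases n) (simp_all add: lin_zero)

lemma multilinear_head:
  assumes "multilinear n \<theta>"
  shows "lin (\<lambda>u. \<theta> ((u, a) # Us) w)" and "lin (\<lambda>v. \<theta> ((a, v) # Us) w)"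
  using assms by (cases n; auto simp: lin_zero contract_def fun_eq_iff)+

lemma multilinear_head_add:
  assumes "multilinear n \<theta>"
  shows "\<theta> ((u + v, a) # Us) w = \<theta> ((u, a) # Us) w + \<theta> ((v, a) # Us) w"
    and "\<theta> ((a, u + v) # Us) w = \<theta> ((a, u) # Us) w + \<theta> ((a, v) # Us) w"
  using multilinear_head[OF assms] by (simp_all add: lin_iff)

lemma multilinear_zero: "multilinear n (\<lambda>_ _. 0)"
  by (induction n) (simp_all add: contract_linear lin_zero)

lemma multilinear_contract: "multilinear n \<theta> \<Longrightarrow> multilinear (n - 1) (contract U \<theta>)"
  by (cases n; cases U) (auto simp: multilinear_zero)

lemma multilinear_plus: "multilinear n \<theta> \<Longrightarrow> multilinear n \<eta> \<Longrightarrow> multilinear n (\<lambda>Us w. \<theta> Us w + \<eta> Us w)"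
  by (induction n arbitrary: \<theta> \<eta>) (simp_all add: contract_linear lin_plus)

lemma multilinear_minus: "multilinear n \<theta> \<Longrightarrow> multilinear n \<eta> \<Longrightarrow> multilinear n (\<lambda>Us w. \<theta> Us w - \<eta> Us w)"
  by (induction n arbitrary: \<theta> \<eta>) (simp_all add: contract_linear lin_minus)

lemma multilinear_scale: "multilinear n \<theta> \<Longrightarrow> multilinear n (\<lambda>Us w. sg c (\<theta> Us w))"
  by (induction n arbitrary: \<theta>) (simp_all add: contract_linear lin_scale)

lemma multilinear_as_cochain: "lin \<phi> \<Longrightarrow> multilinear 0 (as_cochain \<phi>)"
  by (simp add: Nil_eqs contract_as_cochain)

lemma lin_lie_index:
  assumes "multilinear n \<theta>"
  shows "lin (\<lambda>u. lie (u, a) \<theta> Us w)" and "lin (\<lambda>v. lie (a, v) \<theta> Us w)"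
proof -
  have "lin (\<lambda>u. lie (u, a) \<theta> Us w) \<and> lin (\<lambda>v. lie (a, v) \<theta> Us w)"
    using assms
  proof (induction Us arbitrary: \<theta> n)
    case Nil
    then show ?case
      using multilinear_Nil[OF Nil] by (simp add: lin_iff left_action_def additivity homogeneity scale_right_diff_distrib)
  next
    case (Cons A Us)
    have "lin (\<lambda>u. \<theta> (ad_fst (u, a) A # Us) w)" "lin (\<lambda>u. \<theta> (ad_snd (u, a) A # Us) w)"
      "lin (\<lambda>u. \<theta> (ad_fst (a, u) A # Us) w)" "lin (\<lambda>u. \<theta> (ad_snd (a, u) A # Us) w)"
      using multilinear_head[OF Cons.prems] by (simp_all add: lin_iff additivity homogeneity)
    then show ?case
      using Cons.IH[OF multilinear_contract[OF Cons.prems, of A]] by (simp add: lin_minus)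
  qed
  then show "lin (\<lambda>u. lie (u, a) \<theta> Us w)" and "lin (\<lambda>v. lie (a, v) \<theta> Us w)" by auto
qed

text \<open>
  Linearity of \<open>L\<^sub>A \<theta>\<close> and \<open>\<partial>\<theta>\<close> in a vector on which \<open>\<theta>\<close> itself depends, as it does when \<open>\<theta>\<close> is a
  contraction; it reduces to linearity of the two operators in \<open>\<theta>\<close>.
\<close>
lemma lin_family:
  assumes "\<And>Us w. lin (\<lambda>u. F u Us w)"
  shows "lin (\<lambda>u. lie A (F u) Us w)" and "lin (\<lambda>u. coboundary (F u) Us w)"
proof -
  have "F (u + v) = (\<lambda>Us w. F u Us w + F v Us w)" "F (sv c u) = (\<lambda>Us w. sg c (F u Us w))" for u v c
    using assms by (simp_all add: lin_iff fun_eq_iff)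
  then show "lin (\<lambda>u. lie A (F u) Us w)" and "lin (\<lambda>u. coboundary (F u) Us w)"
    by (simp_all add: lin_iff lie_linear coboundary_linear)
qed

lemma multilinear_lie: "multilinear n \<theta> \<Longrightarrow> multilinear n (lie U \<theta>)"
proof (induction n arbitrary: \<theta>)
  case 0
  then show ?case by (simp add: Nil_eqs lin_left_action contract_lie lie_zero)
next
  case (Suc n)
  have head: "lin (\<lambda>u. contract (u, a) \<theta> Us w)" "lin (\<lambda>u. contract (a, u) \<theta> Us w)" for a Us w
    using multilinear_head[OF Suc.prems] by (simp_all add: contract_def)
  have "lin (\<lambda>u. \<theta> (ad_fst U (u, a) # Us) w)" "lin (\<lambda>u. \<theta> (ad_snd U (u, a) # Us) w)"
      "lin (\<lambda>u. \<theta> (ad_fst U (a, u) # Us) w)" "lin (\<lambda>u. \<theta> (ad_snd U (a, u) # Us) w)" for a Us w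
    using multilinear_head[OF Suc.prems] by (simp_all add: lin_iff additivity homogeneity)
  moreover have "lin (\<lambda>u. lie U (contract (u, a) \<theta>) Us w)" "lin (\<lambda>u. lie U (contract (a, u) \<theta>) Us w)" for a Us w
    by (rule lin_family, rule head)+
  moreover have "multilinear n (contract A (lie U \<theta>))" for A
    using Suc.prems unfolding contract_lie by (intro multilinear_minus Suc.IH) auto
  ultimately show ?case
    using Suc.prems by (simp add: Nil_eqs lin_minus left_action_zero)
qed

lemma lin_as_cochain_right:
  assumes "lin \<phi>"
  shows "lin (\<lambda>u. as_cochain (mr_action (u, a) \<phi>) Us w)" "lin (\<lambda>v. as_cochain (mr_action (a, v) \<phi>) Us w)"
  using assms by (simp_all add: as_cochain_def lin_iff mr_action_def inner_def additivity homogeneity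
    scale_right_diff_distrib)

lemma multilinear_coboundary: "multilinear n \<theta> \<Longrightarrow> multilinear (Suc n) (coboundary \<theta>)"
proof (induction n arbitrary: \<theta>)
  have head: "lin (\<lambda>u. coboundary \<theta> ((u, a) # Us) w)" "lin (\<lambda>u. coboundary \<theta> ((a, u) # Us) w)"
    if "multilinear n \<theta>" for n \<theta> a Us w
  proof -
    have "lin (\<lambda>u. contract (u, a) \<theta> Us w)" "lin (\<lambda>u. contract (a, u) \<theta> Us w)" for Us w
      using multilinear_head[OF that] by (simp_all add: contract_def)
    then have "lin (\<lambda>u. coboundary (contract (u, a) \<theta>) Us w)" "lin (\<lambda>u. coboundary (contract (a, u) \<theta>) Us w)"
      by (auto intro: lin_family(2))
    then show "lin (\<lambda>u. coboundary \<theta> ((u, a) # Us) w)" "lin (\<lambda>u. coboundary \<theta> ((a, u) # Us) w)"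
      unfolding coboundary.simps
      by - (rule lin_plus lin_minus lin_lie_index[OF that] lin_as_cochain_right multilinear_Nil[OF that] | assumption)+
  qed
  {
    case 0
    have "contract U (coboundary \<theta>) = (\<lambda>Us w. lie U \<theta> Us w + as_cochain (mr_action U (\<theta> [])) Us w)" for U
      using 0 by (simp add: contract_coboundary coboundary_linear)
    then have "multilinear 0 (contract U (coboundary \<theta>))" for U
      by (simp only:) (intro multilinear_plus multilinear_lie[OF 0] multilinear_as_cochain lin_mr_action)
    then show ?case using head[OF 0] by (simp add: Nil_eqs del: coboundary.simps)
  next
    case (Suc n)
    from Suc.prems have "\<theta> [] = (\<lambda>_. 0)" by simp
    then have "as_cochain (mr_action U (\<theta> [])) = (\<lambda>_ _. 0)" for U
      by (intro ext) (simp add: as_cochain_def mr_action_linear)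
    then have "contract U (coboundary \<theta>) = (\<lambda>Us w. lie U \<theta> Us w - coboundary (contract U \<theta>) Us w)" for U
      by (simp add: contract_coboundary)
    then have "multilinear (Suc n) (contract U (coboundary \<theta>))" for U
      using Suc.prems by (simp only:) (intro multilinear_minus multilinear_lie Suc.IH, auto)
    then show ?case using head[OF Suc.prems] by (simp add: Nil_eqs del: coboundary.simps)
  }
qed

section \<open>The square of the coboundary\<close>

text \<open>
  \<open>L\<^sub>U L\<^sub>A - L\<^sub>A L\<^sub>U = L\<^bsub>[U,A]\<^esub>\<close>. Each contraction produces double brackets that cancel by the Leibniz
  identity in \<open>V \<otimes> V\<close>; the identity \<open>rhoT_comm\<close> is applied inside one argument of \<open>\<theta>\<close>, which is
  where additivity of \<open>\<theta>\<close> in its slots enters.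
\<close>
lemma lie_comm:
  "multilinear n \<theta> \<Longrightarrow> lie U (lie A \<theta>) Us w =
    lie (ad_fst U A) \<theta> Us w + lie (ad_snd U A) \<theta> Us w + lie A (lie U \<theta>) Us w"
proof (induction Us arbitrary: \<theta> n)
  case Nil
  then show ?case by (simp add: Nil_eqs left_action_comm[OF multilinear_Nil, of _ _ U A])
next
  case (Cons B Us)
  show ?case
    by (simp add: contract_lie lie_linear Cons.IH[OF multilinear_contract[OF Cons.prems]])
      (simp add: contract_def rhoT_comm[of U A] multilinear_head_add[OF Cons.prems])
qed

lemma lie_as_cochain_Cons: "lie U (as_cochain \<phi>) (A # Us) w = 0"
  by (simp add: contract_as_cochain lie_linear) (simp add: as_cochain_def)

lemma lie_as_cochain_right:
  "lie U (as_cochain (mr_action A (\<theta> []))) Us w = as_cochain (mr_action (ad_fst U A) (\<theta> [])) Us w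
    + as_cochain (mr_action (ad_snd U A) (\<theta> [])) Us w + as_cochain (mr_action A (lie U \<theta> [])) Us w"
proof (cases Us)
  case Nil
  then show ?thesis by (simp add: Nil_eqs left_action_right)
next
  case (Cons B Vs)
  then show ?thesis by (simp only: lie_as_cochain_Cons) (simp add: as_cochain_def)
qed

text \<open>
  After contraction with \<open>A\<close> the difference of the two sides is
  \<open>(L\<^sub>U L\<^sub>A - L\<^bsub>[U,A]\<^esub> - L\<^sub>A L\<^sub>U)\<theta>\<close>, minus the same difference for \<open>\<iota>\<^sub>A \<theta>\<close>, plus the failure of
  \<open>L\<^sub>U\<close> to be a derivation of \<open>mr_action\<close>, which is zero.
\<close>
lemma lie_coboundary: "multilinear n \<theta> \<Longrightarrow> lie U (coboundary \<theta>) Us w = coboundary (lie U \<theta>) Us w"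
proof (induction Us arbitrary: \<theta> n)
  case Nil
  then show ?case by (simp add: Nil_eqs left_action_linear)
next
  case (Cons A Us)
  show ?case
    unfolding lie.simps(2) coboundary.simps(2) contract_lie contract_coboundary lie_linear coboundary_linear
      lie_as_cochain_right lie_comm[OF Cons.prems, of U A] Cons.IH[OF multilinear_contract[OF Cons.prems, of A]]
    by simp
qed

definition one_cocycle :: "('v \<Rightarrow> 'g) \<Rightarrow> bool" where
  "one_cocycle \<phi> \<longleftrightarrow> (\<forall>U w. left_action U \<phi> w + mr_action U \<phi> w = 0)"

text \<open>
  A one-cocycle gives no contribution on longer lists either, because a cochain of degree one has
  zero contractions.
\<close>
lemma coboundary_one_cocycle:
  assumes "one_cocycle \<phi>"
  shows "coboundary (as_cochain \<phi>) Us w = 0"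
proof (cases Us)
  case (Cons U Vs)
  show ?thesis
  proof (cases Vs)
    case Nil
    then show ?thesis using assms Cons by (simp add: Nil_eqs one_cocycle_def)
  next
    case (Cons A Ws)
    then show ?thesis
      unfolding \<open>Us = U # Vs\<close> coboundary.simps(2)[of _ U] contract_as_cochain coboundary_linear
      by (simp only: lie_as_cochain_Cons) (simp add: as_cochain_def)
  qed
qed simp

lemma one_cocycle_inner: "one_cocycle (inner x y)"
  by (simp add: one_cocycle_def inner_cocycle)

lemma one_cocycle_diff: "one_cocycle \<phi> \<Longrightarrow> one_cocycle \<psi> \<Longrightarrow> one_cocycle (\<lambda>w. \<phi> w - \<psi> w)"
  by (simp add: one_cocycle_def left_action_linear mr_action_linear add_diff_add[symmetric])

lemma one_cocycle_zero: "one_cocycle (\<lambda>w. 0)"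
  by (simp add: one_cocycle_def left_action_linear mr_action_linear)

lemma one_cocycle_scale: "one_cocycle \<phi> \<Longrightarrow> one_cocycle (\<lambda>w. sg c (\<phi> w))"
  by (simp add: one_cocycle_def left_action_linear mr_action_linear scale_right_distrib[symmetric])

lemma one_cocycle_right: "one_cocycle (mr_action U \<phi>)"
  using one_cocycle_diff[OF one_cocycle_inner one_cocycle_inner]
  by (simp add: mr_action_def[abs_def])

lemma coboundary_coboundary: "multilinear n \<theta> \<Longrightarrow> coboundary (coboundary \<theta>) Us w = 0"
proof (induction Us arbitrary: \<theta> n)
  case (Cons U Us)
  have "as_cochain (mr_action U (coboundary \<theta> [])) Us w = 0"
    by (simp add: Nil_eqs as_cochain_def mr_action_linear)
  then show ?case
    unfolding coboundary.simps(2) contract_coboundary coboundary_linear lie_coboundary[OF Cons.prems]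
      Cons.IH[OF multilinear_contract[OF Cons.prems]] coboundary_one_cocycle[OF one_cocycle_right]
    by simp
qed simp

section \<open>The explicit coboundary formula\<close>

lemma lie_sum:
  "lie U \<theta> Us w = adT U (\<theta> Us w) - \<theta> Us (rhoT U w)
    - (\<Sum>i<length Us. \<theta> (Us[i := ad_fst U (Us ! i)]) w)
    - (\<Sum>i<length Us. \<theta> (Us[i := ad_snd U (Us ! i)]) w)"
proof (induction Us arbitrary: \<theta>)
  case (Cons A Us)
  show ?case
    by (simp add: Cons.IH sum.lessThan_Suc_shift del: sum.lessThan_Suc) (simp add: contract_def)
qed (simp add: left_action_def)

lemma omit_Cons: "omit (Suc 0) (U # Us) = Us" "1 \<le> j \<Longrightarrow> omit (Suc j) (U # Us) = U # omit j Us"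
  by (cases j; simp add: omit_def)+

text \<open>
  The common shape of the two double sums in \<open>partial_T\<close>: they are the cases \<open>h = ad_fst\<close> and
  \<open>h = ad_snd\<close>.
\<close>
definition insertions where
  "insertions h \<theta> Us w = (\<Sum>k=1..length Us. \<Sum>j=1..<k.
     sg ((- 1) ^ j) (\<theta> (omit j (Us[k - 1 := h (Us ! (j - 1)) (Us ! (k - 1))])) w))"

text \<open>
  Splitting off the index \<open>j = 1\<close>, which belongs to the first argument. It contributes to the Lie
  derivative; what is left is the same sum for the contracted cochain, shifted by one.
\<close>
lemma sum_triangle:
  fixes f :: "nat \<Rightarrow> nat \<Rightarrow> 'g"
  shows "(\<Sum>k=1..Suc m. \<Sum>j=1..<k. f j k) =
    (\<Sum>k<m. f 1 (Suc (Suc k))) + (\<Sum>k=1..m. \<Sum>j=1..<k. f (Suc j) (Suc k))"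
proof (induction m)
  case (Suc m)
  have "(\<Sum>j=1..<Suc (Suc m). f j (Suc (Suc m))) =
      f 1 (Suc (Suc m)) + (\<Sum>j=1..<Suc m. f (Suc j) (Suc (Suc m)))"
    by (subst sum.atLeast_Suc_lessThan) (simp_all add: sum.shift_bounds_Suc_ivl del: sum.op_ivl_Suc)
  moreover have "(\<Sum>k=1..Suc (Suc m). \<Sum>j=1..<k. f j k) =
      (\<Sum>k=1..Suc m. \<Sum>j=1..<k. f j k) + (\<Sum>j=1..<Suc (Suc m). f j (Suc (Suc m)))"
    by (rule sum.cl_ivl_Suc[THEN trans]) simp
  moreover have "(\<Sum>k=1..Suc m. \<Sum>j=1..<k. f (Suc j) (Suc k)) =
      (\<Sum>k=1..m. \<Sum>j=1..<k. f (Suc j) (Suc k)) + (\<Sum>j=1..<Suc m. f (Suc j) (Suc (Suc m)))"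
    by (rule sum.cl_ivl_Suc[THEN trans]) simp
  ultimately show ?case
    using Suc.IH by (simp only: sum.lessThan_Suc ac_simps)
qed simp

lemma insertions_Cons:
  "insertions h \<theta> (U # Us) w =
     - (\<Sum>i<length Us. \<theta> (Us[i := h U (Us ! i)]) w) - insertions h (contract U \<theta>) Us w"
proof -
  let ?f = "\<lambda>j k. sg ((- 1) ^ j) (\<theta> (omit j ((U # Us)[k - 1 := h ((U # Us) ! (j - 1)) ((U # Us) ! (k - 1))])) w)"
  have "insertions h \<theta> (U # Us) w =
      (\<Sum>k<length Us. ?f 1 (Suc (Suc k))) + (\<Sum>k=1..length Us. \<Sum>j=1..<k. ?f (Suc j) (Suc k))"
    unfolding insertions_def list.size add_Suc_right add_0_right by (rule sum_triangle)
  moreover have "(\<Sum>k<length Us. ?f 1 (Suc (Suc k))) = - (\<Sum>i<length Us. \<theta> (Us[i := h U (Us ! i)]) w)"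
    by (simp add: omit_Cons sum_negf)
  moreover have "(\<Sum>k=1..length Us. \<Sum>j=1..<k. ?f (Suc j) (Suc k)) = - insertions h (contract U \<theta>) Us w"
  proof -
    have "?f (Suc j) (Suc k) = - sg ((- 1) ^ j) (contract U \<theta> (omit j (Us[k - 1 := h (Us ! (j - 1)) (Us ! (k - 1))])) w)"
      if "1 \<le> j" "j < k" for j k
      using that by (cases k; cases j) (simp_all add: omit_Cons contract_def)
    then show ?thesis
      unfolding insertions_def sum_negf[symmetric] by (intro sum.cong refl) auto
  qed
  ultimately show ?thesis by simp
qed

lemma partial_T_insertions:
  assumes "length Us = n"
  shows "partial_T sg br rho T n \<theta> Us w =
    insertions ad_fst \<theta> Us w + insertions ad_snd \<theta> Us w
    + (\<Sum>j=1..n. sg ((- 1) ^ j) (\<theta> (omit j Us) (rhoT (Us ! (j - 1)) w))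
        + sg ((- 1) ^ (j + 1)) (adT (Us ! (j - 1)) (\<theta> (omit j Us) w)))
    + sg ((- 1) ^ (n + 1)) (mr_action (Us ! (n - 1)) (\<theta> (butlast Us)) w)"
  using assms
  by (simp add: partial_T_def insertions_def Let_def br_T_def l_T_def m_T_def r_T_def
    mr_action_def inner_def)

text \<open>
  All terms with \<open>j = 1\<close> make up the Lie derivative along \<open>U\<close>. In all others, including the last
  one for two or more arguments, the exponent of the sign drops by one when \<open>U\<close> is contracted.
  With one argument the last term is itself about \<open>U\<close>.
\<close>
lemma partial_T_Cons:
  "partial_T sg br rho T (Suc (length Us)) \<theta> (U # Us) w =
    lie U \<theta> Us w - (if Us = [] then 0 else partial_T sg br rho T (length Us) (contract U \<theta>) Us w)
    + as_cochain (mr_action U (\<theta> [])) Us w"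
proof -
  let ?g = "\<lambda>\<theta> Us j. sg ((- 1) ^ j) (\<theta> (omit j Us) (rhoT (Us ! (j - 1)) w))
        + sg ((- 1) ^ (j + 1)) (adT (Us ! (j - 1)) (\<theta> (omit j Us) w))"
  have "(\<Sum>j=1..Suc (length Us). ?g \<theta> (U # Us) j) =
      ?g \<theta> (U # Us) 1 + (\<Sum>j=1..length Us. ?g \<theta> (U # Us) (Suc j))"
    by (simp only: sum.atLeast_Suc_atMost sum.shift_bounds_cl_Suc_ivl One_nat_def le_add1 plus_1_eq_Suc)
  also have "(\<Sum>j=1..length Us. ?g \<theta> (U # Us) (Suc j)) = - (\<Sum>j=1..length Us. ?g (contract U \<theta>) Us j)"
    unfolding sum_negf[symmetric]
  proof (intro sum.cong refl)
    fix j assume "j \<in> {1..length Us}"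
    then show "?g \<theta> (U # Us) (Suc j) = - ?g (contract U \<theta>) Us j"
      by (cases j) (simp_all add: omit_Cons contract_def)
  qed
  also have "?g \<theta> (U # Us) 1 = adT U (\<theta> Us w) - \<theta> Us (rhoT U w)"
    by (simp add: omit_Cons)
  finally have single: "(\<Sum>j=1..Suc (length Us). ?g \<theta> (U # Us) j) =
      adT U (\<theta> Us w) - \<theta> Us (rhoT U w) - (\<Sum>j=1..length Us. ?g (contract U \<theta>) Us j)"
    by simp
  show ?thesis
  proof (cases "Us = []")
    case True
    then show ?thesis
      by (subst partial_T_insertions)
        (simp_all add: insertions_def omit_Cons left_action_def as_cochain_def)
  next
    case False
    have "sg ((- 1) ^ (Suc (length Us) + 1)) (mr_action ((U # Us) ! (Suc (length Us) - 1)) (\<theta> (butlast (U # Us))) w)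
      = - sg ((- 1) ^ (length Us + 1)) (mr_action (Us ! (length Us - 1)) (contract U \<theta> (butlast Us)) w)"
      using False by (cases Us) (simp_all add: contract_def)
    moreover have "as_cochain (mr_action U (\<theta> [])) Us w = 0" using False by (simp add: as_cochain_def)
    moreover have "partial_T sg br rho T (Suc (length Us)) \<theta> (U # Us) w =
      insertions ad_fst \<theta> (U # Us) w + insertions ad_snd \<theta> (U # Us) w
      + (\<Sum>j=1..Suc (length Us). ?g \<theta> (U # Us) j)
      + sg ((- 1) ^ (Suc (length Us) + 1)) (mr_action ((U # Us) ! (Suc (length Us) - 1)) (\<theta> (butlast (U # Us))) w)"
      by (rule partial_T_insertions) simp
    ultimately show ?thesis
      using False partial_T_insertions[of Us "length Us" "contract U \<theta>" w]
      unfolding single insertions_Cons lie_sum by simp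
  qed
qed

lemma partial_T_eq_coboundary:
  assumes "length Us = Suc n"
  shows "partial_T sg br rho T (Suc n) \<theta> Us w = coboundary \<theta> Us w"
  using assms
proof (induction Us arbitrary: \<theta> n)
  case (Cons U Us)
  then have n: "n = length Us" by simp
  show ?case
  proof (cases Us)
    case Nil
    then show ?thesis by (simp only: n partial_T_Cons) simp
  next
    case (Cons A Vs)
    then have "partial_T sg br rho T (length Us) (contract U \<theta>) Us w = coboundary (contract U \<theta>) Us w"
      using Cons.IH[of "length Vs" "contract U \<theta>"] by simp
    then show ?thesis using Cons by (simp only: n partial_T_Cons) simp
  qed
qed simp

text \<open>
  The shift by one is that of the degree: a cochain of degree \<open>n + 1\<close> takes \<open>n\<close> pairs. Slot \<open>i + 1\<close> of
  a cochain is slot \<open>i\<close> of its contraction.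
\<close>
lemma C_3Leib_iff_multilinear: "\<theta> \<in> C_3Leib sv sg (Suc n) \<longleftrightarrow> multilinear n \<theta>"
proof (induction n arbitrary: \<theta>)
  case 0
  have "(\<forall>Us w. length Us \<noteq> 0 \<longrightarrow> \<theta> Us w = 0) \<longleftrightarrow> (\<forall>U. contract U \<theta> = (\<lambda>_ _. 0))"
    by (force simp: contract_def fun_eq_iff neq_Nil_conv)
  then show ?case by (auto simp: C_3Leib_def)
next
  case (Suc n)
  show ?case
  proof
    assume \<theta>: "\<theta> \<in> C_3Leib sv sg (Suc (Suc n))"
    have len: "\<theta> Us = (\<lambda>_. 0)" if "length Us \<noteq> Suc n" for Us
      using \<theta> that by (simp add: C_3Leib_def fun_eq_iff)
    have linw: "lin (\<theta> Us)" if "length Us = Suc n" for Us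
      using \<theta> that by (simp add: C_3Leib_def)
    have slot: "lin (\<lambda>u. \<theta> (Us[i := (u, a)]) w)" "lin (\<lambda>v. \<theta> (Us[i := (a, v)]) w)"
      if "length Us = Suc n" "i < Suc n" for Us i a w
      using \<theta> that by (simp_all add: C_3Leib_def)
    have "lin (\<lambda>u. \<theta> ((u, a) # Us) w)" "lin (\<lambda>v. \<theta> ((a, v) # Us) w)" for a Us w
      using slot[of "(a, a) # Us" 0 a w] by (cases "length Us = n"; simp add: len lin_zero)+
    moreover have "contract U \<theta> \<in> C_3Leib sv sg (Suc n)" for U
      unfolding C_3Leib_def using linw[of "U # _"] slot[of "U # _" "Suc _"]
      by (auto simp: contract_def len)
    ultimately show "multilinear (Suc n) \<theta>"
      using len[of "[]"] by (simp add: Suc.IH)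
  next
    assume \<theta>: "multilinear (Suc n) \<theta>"
    then have c: "contract U \<theta> \<in> C_3Leib sv sg (Suc n)" for U
      by (simp add: Suc.IH)
    have "\<theta> Us w = 0" if "length Us \<noteq> Suc n" for Us w
    proof (cases Us)
      case Nil
      then show ?thesis using \<theta> by simp
    next
      case (Cons U Vs)
      then show ?thesis using c[of U] that by (simp add: C_3Leib_def contract_def)
    qed
    moreover have "lin (\<theta> Us)" if "length Us = Suc n" for Us
      using that c[of "hd Us"] by (cases Us) (simp_all add: C_3Leib_def contract_def)
    moreover have "lin (\<lambda>u. \<theta> (Us[i := (u, a)]) w)" "lin (\<lambda>v. \<theta> (Us[i := (a, v)]) w)"
      if "length Us = Suc n" "i < Suc n" for Us i a w
    proof -
      obtain U Vs where Us: "Us = U # Vs" using \<open>length Us = Suc n\<close> by (cases Us) auto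
      have "lin (\<lambda>u. \<theta> (Us[i := (u, a)]) w) \<and> lin (\<lambda>v. \<theta> (Us[i := (a, v)]) w)"
        using multilinear_head[OF \<theta>, of a Vs w] c[of U] that
        by (cases i) (simp_all add: Us C_3Leib_def contract_def)
      then show "lin (\<lambda>u. \<theta> (Us[i := (u, a)]) w)" "lin (\<lambda>v. \<theta> (Us[i := (a, v)]) w)"
        by blast+
    qed
    ultimately show "\<theta> \<in> C_3Leib sv sg (Suc (Suc n))"
      by (simp add: C_3Leib_def)
  qed
qed

lemma partial_T_cochain:
  assumes "\<theta> \<in> C_3Leib sv sg (Suc n)"
  shows "partial_T sg br rho T (Suc n) \<theta> = coboundary \<theta>"
proof (intro ext)
  fix Us w
  have "coboundary \<theta> \<in> C_3Leib sv sg (Suc (Suc n))"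
    using assms by (simp add: C_3Leib_iff_multilinear multilinear_coboundary del: multilinear.simps)
  then show "partial_T sg br rho T (Suc n) \<theta> Us w = coboundary \<theta> Us w"
    by (cases "length Us = Suc n") (simp_all add: partial_T_eq_coboundary, simp add: C_3Leib_def partial_T_def)
qed

section \<open>The complex\<close>

lemma carrier_C_T_Suc:
  "x \<in> carrier (C_T sg sv (Suc (Suc n))) \<longleftrightarrow> (\<exists>\<theta>. x = Leib \<theta> \<and> multilinear n \<theta>)"
  by (auto simp: C_T_def C_3Leib_iff_multilinear)

lemma module_multilinear: "Module.module ring_of_type_algebra (C_T sg sv (Suc (Suc n)))"
proof -
  let ?M = "C_T sg sv (Suc (Suc n))"
  have inverse: "\<exists>y\<in>carrier ?M. y \<oplus>\<^bsub>?M\<^esub> x = \<zero>\<^bsub>?M\<^esub>" if "x \<in> carrier ?M" for x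
  proof -
    from that obtain \<theta> where \<theta>: "x = Leib \<theta>" "multilinear n \<theta>" unfolding carrier_C_T_Suc by blast
    have "cochain_add sg (Leib (\<lambda>Us w. 0 - \<theta> Us w)) x = Leib (\<lambda>_ _. 0)"
      by (simp add: \<theta>(1))
    moreover have "Leib (\<lambda>Us w. 0 - \<theta> Us w) \<in> carrier ?M"
      using multilinear_minus[OF multilinear_zero \<theta>(2)] by (simp add: carrier_C_T_Suc)
    ultimately show ?thesis unfolding C_T_simps by (rule bexI)
  qed
  have "abelian_group ?M"
  proof (rule abelian_groupI)
    show "\<zero>\<^bsub>?M\<^esub> \<in> carrier ?M" by (simp add: carrier_C_T_Suc C_T_simps multilinear_zero)
    show "x \<oplus>\<^bsub>?M\<^esub> y \<in> carrier ?M" if "x \<in> carrier ?M" "y \<in> carrier ?M" for x y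
      using that by (clarsimp simp: carrier_C_T_Suc C_T_simps multilinear_plus)
    show "(x \<oplus>\<^bsub>?M\<^esub> y) \<oplus>\<^bsub>?M\<^esub> z = x \<oplus>\<^bsub>?M\<^esub> (y \<oplus>\<^bsub>?M\<^esub> z)"
      if "x \<in> carrier ?M" "y \<in> carrier ?M" "z \<in> carrier ?M" for x y z
      using that by (clarsimp simp: carrier_C_T_Suc C_T_simps add.assoc)
    show "x \<oplus>\<^bsub>?M\<^esub> y = y \<oplus>\<^bsub>?M\<^esub> x" if "x \<in> carrier ?M" "y \<in> carrier ?M" for x y
      using that by (clarsimp simp: carrier_C_T_Suc C_T_simps add.commute)
    show "\<zero>\<^bsub>?M\<^esub> \<oplus>\<^bsub>?M\<^esub> x = x" if "x \<in> carrier ?M" for x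
      using that by (clarsimp simp: carrier_C_T_Suc C_T_simps)
  qed (rule inverse)
  moreover have "cring (ring_of_type_algebra :: 'k ring)" by (rule cring_from_type_algebra)
  ultimately show ?thesis
    by (intro moduleI; clarsimp simp: carrier_C_T_Suc C_T_simps ring_of_type_algebra_simps
        multilinear_scale scale_left_distrib scale_right_distrib)
qed

text \<open>
  An element of the exterior square is a class of linear combinations of pairs, so \<open>\<delta>\<close> of it is a
  combination of the maps \<open>inner x y\<close>, and a linear property of these maps passes to it.
\<close>
lemma inner_combination_closed:
  assumes "P (\<lambda>_. 0)" and diff: "\<And>\<phi> \<psi>. P \<phi> \<Longrightarrow> P \<psi> \<Longrightarrow> P (\<lambda>v. \<phi> v - \<psi> v)"
    and scale: "\<And>c \<phi>. P \<phi> \<Longrightarrow> P (\<lambda>v. sg c (\<phi> v))" and inner: "\<And>x y. P (inner x y)"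
  shows "P (\<lambda>v. - free_lift sg (\<lambda>x y. inner x y v) f)"
proof -
  have "P (\<lambda>v. - (\<Sum>p\<in>A. sg (Poly_Mapping.lookup f p) (inner (fst p) (snd p) v)))"
    if "finite A" for A :: "('g \<times> 'g) set"
    using that
  proof (induction A rule: finite_induct)
    case (insert p A)
    have "P (\<lambda>v. - (\<Sum>p\<in>A. sg (Poly_Mapping.lookup f p) (inner (fst p) (snd p) v))
        - sg (Poly_Mapping.lookup f p) (inner (fst p) (snd p) v))"
      by (rule diff[OF insert.IH scale[OF inner]])
    moreover have "(\<lambda>v. - (\<Sum>p\<in>insert p A. sg (Poly_Mapping.lookup f p) (inner (fst p) (snd p) v)))
      = (\<lambda>v. - (\<Sum>p\<in>A. sg (Poly_Mapping.lookup f p) (inner (fst p) (snd p) v))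
        - sg (Poly_Mapping.lookup f p) (inner (fst p) (snd p) v))"
      using insert.hyps by (simp add: fun_eq_iff)
    ultimately show ?case by (simp only:)
  qed (simp add: assms(1))
  then show ?thesis by (simp add: free_lift_def)
qed

text \<open>
  The bracket has to be alternating, not only skew-symmetric, for \<open>(x, y) \<mapsto> [x,y,z]\<close> to factor through
  the exterior square. Over a field of characteristic two this is an extra condition.
\<close>
context
  assumes br_alternating: "\<And>x z. br x x z = 0"
begin

lemma delta_T_class:
  "delta_T sg br sv rho T (wedge_rel sg `` {f}) v = - free_lift sg (\<lambda>x y. inner x y v) f"
proof -
  interpret T: Vector_Spaces.linear sv sg T by (rule T_linear)
  have "T (free_lift sv (\<lambda>x y. rho x y v) f) = free_lift sg (\<lambda>x y. T (rho x y v)) f"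
    by (simp add: free_lift_def T.sum T.scale)
  then show ?thesis
    by (simp add: delta_T_def wedge_lift_class rho_linear1 rho_linear2 rho_alternating
      br_linear1 br_linear2 br_alternating free_lift_def inner_def scale_right_diff_distrib sum_subtractf)
qed

lemma lin_delta_T: "lin (delta_T sg br sv rho T (wedge_rel sg `` {f}))"
  unfolding delta_T_class[abs_def]
  by (rule inner_combination_closed[where P = lin]) (rule lin_zero lin_minus lin_scale lin_inner; assumption)+

lemma one_cocycle_delta_T: "one_cocycle (delta_T sg br sv rho T (wedge_rel sg `` {f}))"
  unfolding delta_T_class[abs_def]
  by (rule inner_combination_closed[where P = one_cocycle])
    (rule one_cocycle_zero one_cocycle_diff one_cocycle_scale one_cocycle_inner; assumption)+

lemma d_T_Ext:
  "d_T sg br sv rho T k (Ext \<XX>) = Leib (as_cochain (delta_T sg br sv rho T \<XX>))"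
  by (simp add: as_cochain_def)

lemma d_T_Leib:
  "multilinear n \<theta> \<Longrightarrow> d_T sg br sv rho T (Suc (Suc n)) (Leib \<theta>) = Leib (coboundary \<theta>)"
  by (simp add: partial_T_cochain C_3Leib_iff_multilinear)

lemma d_T_module_maps_1:
  "d_T sg br sv rho T (Suc 0) \<in>
     module_maps ring_of_type_algebra (C_T sg sv (Suc 0)) (C_T sg sv (Suc (Suc 0)))"
proof -
  interpret L: Vector_Spaces.linear free_scale sg "free_lift sg B" for B :: "'g \<Rightarrow> 'g \<Rightarrow> 'g"
    by (rule linear_free_lift) (rule vector_space_axioms)
  have add: "as_cochain (delta_T sg br sv rho T (wedge_rel sg `` {f + g})) =
      (\<lambda>Us w. as_cochain (delta_T sg br sv rho T (wedge_rel sg `` {f})) Us w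
        + as_cochain (delta_T sg br sv rho T (wedge_rel sg `` {g})) Us w)" for f g
    by (simp add: as_cochain_def delta_T_class L.add fun_eq_iff)
  have scale: "as_cochain (delta_T sg br sv rho T (wedge_rel sg `` {free_scale c f})) =
      (\<lambda>Us w. sg c (as_cochain (delta_T sg br sv rho T (wedge_rel sg `` {f})) Us w))" for c f
    by (simp add: as_cochain_def delta_T_class L.scale fun_eq_iff)
  show ?thesis
    unfolding module_maps_def
    by (auto simp: carrier_C_T_1 carrier_C_T_Suc C_T_simps d_T_Ext wedge_add_class
      wedge_smult_class add scale multilinear_as_cochain lin_delta_T simp del: d_T.simps multilinear.simps)
qed

lemma d_T_module_maps_Leib:
  "d_T sg br sv rho T (Suc (Suc n)) \<in>
     module_maps ring_of_type_algebra (C_T sg sv (Suc (Suc n))) (C_T sg sv (Suc (Suc (Suc n))))"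
proof -
  have "coboundary (\<lambda>Us w. \<theta> Us w + \<eta> Us w) = (\<lambda>Us w. coboundary \<theta> Us w + coboundary \<eta> Us w)"
    "coboundary (\<lambda>Us w. sg c (\<theta> Us w)) = (\<lambda>Us w. sg c (coboundary \<theta> Us w))" for \<theta> \<eta> c
    by (simp_all add: fun_eq_iff coboundary_linear)
  then show ?thesis
    unfolding module_maps_def
    by (auto simp: carrier_C_T_Suc C_T_simps d_T_Leib multilinear_plus multilinear_scale multilinear_coboundary
      simp del: d_T.simps multilinear.simps)
qed

lemma d_T_d_T:
  assumes "k \<ge> 1" and "x \<in> carrier (C_T sg sv k)"
  shows "d_T sg br sv rho T (k + 1) (d_T sg br sv rho T k x) = \<zero>\<^bsub>C_T sg sv (k + 2)\<^esub>"
proof -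
  have zero: "\<zero>\<^bsub>C_T sg sv (k + 2)\<^esub> = Leib (\<lambda>_ _. 0)"
    using assms(1) by (simp add: C_T_def)
  show ?thesis
  proof (cases "k = 1")
    case True
    then obtain f where x: "x = Ext (wedge_rel sg `` {f})"
      using assms(2) by (auto simp: carrier_C_T_1)
    let ?\<phi> = "delta_T sg br sv rho T (wedge_rel sg `` {f})"
    have "d_T sg br sv rho T (k + 1) (d_T sg br sv rho T k x) = Leib (coboundary (as_cochain ?\<phi>))"
      using d_T_Leib[OF multilinear_as_cochain[OF lin_delta_T]] True
      unfolding x d_T_Ext by (simp del: d_T.simps)
    also have "coboundary (as_cochain ?\<phi>) = (\<lambda>_ _. 0)"
      using coboundary_one_cocycle[OF one_cocycle_delta_T] by (simp add: fun_eq_iff)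
    finally show ?thesis unfolding zero .
  next
    case False
    then obtain n where k: "k = Suc (Suc n)"
      using assms(1) that[of "k - 2"] by linarith
    then obtain \<theta> where \<theta>: "multilinear n \<theta>" "x = Leib \<theta>"
      using assms(2) unfolding k carrier_C_T_Suc by blast
    have "d_T sg br sv rho T (k + 1) (d_T sg br sv rho T k x) = Leib (coboundary (coboundary \<theta>))"
      using d_T_Leib[OF \<theta>(1)] d_T_Leib[OF multilinear_coboundary[OF \<theta>(1)]]
      by (simp add: k \<theta>(2) del: d_T.simps)
    also have "coboundary (coboundary \<theta>) = (\<lambda>_ _. 0)"
      using coboundary_coboundary[OF \<theta>(1)] by (simp add: fun_eq_iff)
    finally show ?thesis unfolding zero .
  qed
qed

lemma cochain_complex_d_T: "cochain_complex ring_of_type_algebra (C_T sg sv) (d_T sg br sv rho T)"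
  unfolding cochain_complex_def
proof (intro conjI allI impI ballI)
  fix k :: nat assume k: "1 \<le> k"
  then consider "k = 1" | n where "k = Suc (Suc n)"
    using that(2)[of "k - 2"] by linarith
  note cases = this
  from cases show "Module.module ring_of_type_algebra (C_T sg sv k)"
    using module_exterior_square module_multilinear by cases auto
  from cases show "d_T sg br sv rho T k \<in> module_maps ring_of_type_algebra (C_T sg sv k) (C_T sg sv (k + 1))"
  proof cases
    case 1
    then show ?thesis using d_T_module_maps_1 by simp
  next
    case 2
    then show ?thesis using d_T_module_maps_Leib by simp
  qed
  show "d_T sg br sv rho T (k + 1) (d_T sg br sv rho T k x) = \<zero>\<^bsub>C_T sg sv (k + 2)\<^esub>"
    if "x \<in> carrier (C_T sg sv k)" for x
    using k that by (rule d_T_d_T)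
qed

end

end

theorem theorem4p5:
  fixes sg :: "'k::{alg_closed_field, field_char_0} \<Rightarrow> 'g::ab_group_add \<Rightarrow> 'g"
    and br :: "'g \<Rightarrow> 'g \<Rightarrow> 'g \<Rightarrow> 'g"
    and sv :: "'k \<Rightarrow> 'v::ab_group_add \<Rightarrow> 'v"
    and rho :: "'g \<Rightarrow> 'g \<Rightarrow> 'v \<Rightarrow> 'v"
    and T :: "'v \<Rightarrow> 'g"
  assumes "three_lie_algebra sg br"
    and "three_lie_representation sg br sv rho"
    and "embedding_tensor sg br sv rho T"
  shows "cochain_complex ring_of_type_algebra (C_T sg sv) (d_T sg br sv rho T)"
proof -
  interpret embedding_tensor sg br sv rho T by fact
  \<comment> \<open>Skew-symmetry gives \<open>2 [x,x,z] = 0\<close>, and the characteristic is zero.\<close>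
  have "br x x z = 0" for x z
  proof -
    have "sg 2 (br x x z) = br x x z + br x x z"
      using scale_left_distrib[of 1 1 "br x x z"] by simp
    also have "\<dots> = 0"
      using br_skew12[of x x z] by (simp add: eq_neg_iff_add_eq_0)
    finally show ?thesis by simp
  qed
  then show ?thesis by (rule cochain_complex_d_T)
qed

end
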